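(* Let $f_1,f_2\in\mathbb{C}[h]$. Then $\mathcal{H}(f_1)\cong\mathcal{H}(f_2)$ as $\mathbb{C}$-algebras if and only if one of the following holds: (1) $f_1,f_2\in\mathbb{C}$ (both constant); (2) $f_1=f_2=h$; (3) $f_1=h+c_1$ and $f_2=h+c_2$ for some $c_1,c_2\in\mathbb{C}^*$; (4) $f_1=a_1h+b_1$ and $f_2=a_2h+b_2$ with $a_1,a_2,b_1,b_2\in\mathbb{C}$ and $a_1=a_2^{\pm1}\neq 1$; (5) $\deg f_1\ge 2$ and $f_2(h)=af_1(a^{-1}(h-c))+c$ for some $a\in\mathbb{C}^*$, $c\in\mathbb{C}$.
   Context: For $f(h)\in\mathbb{C}[h]$, $\mathcal{H}(f)$ is the unital associative $\mathbb{C}$-algebra generated by $x,y,h$ with relations $hx=xf(h)$, $yh=f(h)y$, $yx-xy=f(h)-h$. *)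

theory Defs
  imports "HOL-Library.Poly_Mapping" "HOL-Computational_Algebra.Polynomial" "HOL-Algebra.QuotRing"
begin

datatype gen = Xg | Yg | Hg

datatype word = Word "gen list"

instantiation word :: monoid_add
begin
definition zero_word :: word where "zero_word = Word []"
fun plus_word :: "word \<Rightarrow> word \<Rightarrow> word" where
  "plus_word (Word u) (Word v) = Word (u @ v)"
instance
proof
  fix a b c :: word
  show "a + b + c = a + (b + c)" by (cases a; cases b; cases c) simp
  show "0 + a = a" by (cases a) (simp add: zero_word_def)
  show "a + 0 = a" by (cases a) (simp add: zero_word_def)
qed
end

text \<open>The free unital associative complex algebra C<x,y,h>: finitely supported
  complex-valued functions on words, with convolution product.\<close>
type_synonym freealg = "word \<Rightarrow>\<^sub>0 complex"

definition FreeR :: "freealg ring" where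
  "FreeR = \<lparr>carrier = UNIV, mult = (*), one = 1, zero = 0, add = (+)\<rparr>"

definition scal :: "complex \<Rightarrow> freealg" where
  "scal c = Poly_Mapping.single (Word []) c"

definition xv :: freealg where "xv = Poly_Mapping.single (Word [Xg]) 1"
definition yv :: freealg where "yv = Poly_Mapping.single (Word [Yg]) 1"
definition hv :: freealg where "hv = Poly_Mapping.single (Word [Hg]) 1"

definition f_at_h :: "complex poly \<Rightarrow> freealg" where
  "f_at_h f = (\<Sum>i\<le>degree f. scal (coeff f i) * hv ^ i)"

definition rels :: "complex poly \<Rightarrow> freealg set" where
  "rels f = { hv * xv - xv * f_at_h f,
              yv * hv - f_at_h f * yv,
              (yv * xv - xv * yv) - (f_at_h f - hv) }"

definition relideal :: "complex poly \<Rightarrow> freealg set" where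
  "relideal f = genideal FreeR (rels f)"

definition HAlg :: "complex poly \<Rightarrow> freealg set ring" where
  "HAlg f = FreeR Quot relideal f"

text \<open>Isomorphism of C-algebras: a (unital) ring isomorphism which is compatible with the
  embedding of the scalars C (equivalently, C-linear).\<close>
definition alg_iso :: "complex poly \<Rightarrow> complex poly \<Rightarrow> bool" where
  "alg_iso f1 f2 \<longleftrightarrow>
     (\<exists>\<phi>. \<phi> \<in> ring_iso (HAlg f1) (HAlg f2) \<and>
          (\<forall>c. \<phi> (relideal f1 +>\<^bsub>FreeR\<^esub> scal c) = relideal f2 +>\<^bsub>FreeR\<^esub> scal c))"

end

theory Submission
  imports Defs "HOL-Library.Function_Algebras"
begin

text \<open>
The monomials \<open>x\<^sup>i h\<^sup>j y\<^sup>k\<close> form a basis of \<open>H(f)\<close>: they span, and the left regular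
representation, written down explicitly on coefficient families, separates them.

Suppose \<open>deg f \<ge> 1\<close>. Taking the lexicographically leading pair \<open>(k,i)\<close> is additive under
multiplication, so \<open>H(f)\<close> is a domain; for constant \<open>f = c\<close> it is not, because \<open>(h - c) x = 0\<close>.
If \<open>deg f\<^sub>1 \<ge> 2\<close> and \<open>H(f\<^sub>1) \<cong> H(f\<^sub>2)\<close>, the relation \<open>h x = x f\<^sub>1(h)\<close> forces the image of \<open>h\<close>
to have leading pair \<open>(0,0)\<close>, that is, to be a polynomial \<open>p(h)\<close>; the inverse isomorphism makes
\<open>p\<close> affine. A coefficient of the image of \<open>x\<close> then gives an identity between
\<open>p\<close> composed with the \<open>i\<close>-th iterate of \<open>f\<^sub>2\<close> and \<open>f\<^sub>1 \<circ> p\<close> composed with the \<open>k\<close>-th iterate.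
Degrees give \<open>i = k + 1\<close>, and cancelling the iterate leaves \<open>p \<circ> f\<^sub>2 = f\<^sub>1 \<circ> p\<close>.

For \<open>f\<close> of degree one, a fixed point of \<open>f\<close> yields a homomorphism onto \<open>C[x,y]\<close>, which separates
\<open>h + c\<close> (where \<open>y x - x y = c\<close>) from \<open>a h + b\<close> with \<open>a \<noteq> 1\<close>. In the latter case one may take
\<open>b = 0\<close>; then \<open>h\<close> generates the commutator ideal, so an isomorphism maps \<open>h\<close> to a scalar multiple of
\<open>h\<close>. Hence the images of \<open>x\<close> and \<open>y\<close> are eigenvectors for commutation with \<open>h\<close>, and unless
\<open>a\<^sub>1 = a\<^sub>2\<close> or \<open>a\<^sub>1 a\<^sub>2 = 1\<close> they have no linear term in \<open>x\<close>, which contradicts surjectivity.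
\<close>

subsection \<open>Homomorphisms out of the free algebra\<close>

definition gen_elem :: "gen \<Rightarrow> freealg" where
  "gen_elem g = Poly_Mapping.single (Word [g]) 1"

lemma gen_elem_simps: "gen_elem Xg = xv" "gen_elem Yg = yv" "gen_elem Hg = hv"
  by (simp_all add: gen_elem_def xv_def yv_def hv_def)

lemma single_Word_eq:
  "Poly_Mapping.single (Word l) c = scal c * prod_list (map gen_elem l)"
proof (induction l rule: rev_induct)
  case Nil
  have "(1::freealg) = Poly_Mapping.single (Word []) 1"
    by (metis single_one zero_word_def)
  then show ?case by (simp add: scal_def)
next
  case (snoc g l)
  have "Poly_Mapping.single (Word (l @ [g])) c = Poly_Mapping.single (Word l) c * gen_elem g"
    by (simp add: gen_elem_def mult_single)
  then show ?case using snoc by (simp add: mult.assoc)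
qed

lemma scal_add: "scal (a + b) = scal a + scal b"
  by (simp add: scal_def single_add)

lemma scal_mult: "scal (a * b) = scal a * scal b"
  by (simp add: scal_def mult_single)

lemma scal_1: "scal 1 = 1"
  by (metis scal_def single_one zero_word_def)

lemma scal_0: "scal 0 = 0"
  by (simp add: scal_def)

lemma poly_mapping_single_induct:
  assumes "P 0" "\<And>u w c. P u \<Longrightarrow> P (u + Poly_Mapping.single w c)"
  shows "P (u :: 'a \<Rightarrow>\<^sub>0 'b::ab_group_add)"
proof (induction u rule: update_induct)
  case const
  then show ?case by (rule assms(1))
next
  case (update u w c)
  then have "Poly_Mapping.update w c u = u + Poly_Mapping.single w c"
    by (intro poly_mapping_eqI) (auto simp: lookup_update lookup_add lookup_single in_keys_iff when_def)
  then show ?case using assms(2)[OF update(3)] by simp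
qed

text \<open>Every basis word is a product of generators. Spanning, agreement of homomorphisms on
  generators and the compatibility with \<open>chi\<close> are all proved by this rule.\<close>

lemma freealg_induct [case_names scal x y h add mult]:
  assumes "\<And>c. P (scal c)" "P xv" "P yv" "P hv"
    and "\<And>u v. P u \<Longrightarrow> P v \<Longrightarrow> P (u + v)" "\<And>u v. P u \<Longrightarrow> P v \<Longrightarrow> P (u * v)"
  shows "P u"
proof (induction u rule: poly_mapping_single_induct)
  case 1
  then show ?case using assms(1)[of 0] by (simp add: scal_0)
next
  case (2 u w c)
  obtain l where w: "w = Word l" by (cases w)
  have g: "P (gen_elem g)" for g
    using assms(2-4) by (cases g) (simp_all add: gen_elem_simps)
  have "P (prod_list (map gen_elem l))"
    using assms(1)[of 1] by (induction l) (simp_all add: scal_1 g assms(6))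
  then show ?case
    using assms(1,5,6) 2 by (simp add: w single_Word_eq)
qed

lemma scal_comm: "scal c * u = u * scal c"
proof -
  have "scal c * Poly_Mapping.single w d = Poly_Mapping.single w d * scal c" for w d
    by (cases w) (simp add: scal_def mult_single mult.commute)
  then show ?thesis
    by (induction u rule: poly_mapping_single_induct) (simp_all add: distrib_left distrib_right)
qed

text \<open>The map sigma supplies the scalars of the codomain, so one notion covers endomorphisms
  of the free algebra, operator representations and maps to \<open>C[x,y]\<close>.\<close>

definition alg_hom :: "(complex \<Rightarrow> 'a::ring_1) \<Rightarrow> (freealg \<Rightarrow> 'a) \<Rightarrow> bool" where
  "alg_hom \<sigma> T \<longleftrightarrow> (\<forall>u v. T (u + v) = T u + T v) \<and> (\<forall>u v. T (u * v) = T u * T v) \<and>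
     (\<forall>c. T (scal c) = \<sigma> c)"

lemma alg_homD:
  assumes "alg_hom \<sigma> T"
  shows alg_hom_add: "T (u + v) = T u + T v" and alg_hom_mult: "T (u * v) = T u * T v"
    and alg_hom_scal: "T (scal c) = \<sigma> c"
  using assms by (auto simp: alg_hom_def)

lemma alg_hom_zero: assumes "alg_hom \<sigma> T" shows "T 0 = 0"
  using alg_hom_add[OF assms, of 0 0] by simp

lemma alg_hom_diff: assumes "alg_hom \<sigma> T" shows "T (u - v) = T u - T v"
  using alg_hom_add[OF assms, of "u - v" v] by simp

lemma alg_hom_sum: assumes "alg_hom \<sigma> T" shows "T (sum g A) = (\<Sum>a\<in>A. T (g a))"
  by (induction A rule: infinite_finite_induct)
    (simp_all add: alg_hom_zero[OF assms] alg_hom_add[OF assms])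

definition two_sided :: "'a::ring_1 set \<Rightarrow> bool" where
  "two_sided I \<longleftrightarrow> 0 \<in> I \<and> (\<forall>u\<in>I. \<forall>v\<in>I. u + v \<in> I) \<and> (\<forall>u\<in>I. \<forall>a. a * u \<in> I \<and> u * a \<in> I)"

lemma two_sided_uminus: "two_sided I \<Longrightarrow> u \<in> I \<Longrightarrow> - u \<in> I"
  by (metis mult_minus1 two_sided_def)

lemma two_sided_trans: "two_sided I \<Longrightarrow> u - v \<in> I \<Longrightarrow> v - w \<in> I \<Longrightarrow> u - w \<in> I"
  by (metis diff_add_cancel diff_diff_eq2 add_diff_eq two_sided_def)

lemma two_sided_sym: "two_sided I \<Longrightarrow> u - v \<in> I \<Longrightarrow> v - u \<in> I"
  by (metis minus_diff_eq two_sided_uminus)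

lemma two_sided_mult:
  assumes "two_sided I" "u - u' \<in> I" "v - v' \<in> I"
  shows "u * v - u' * v' \<in> I"
proof -
  have "u * v - u' * v' = (u - u') * v + u' * (v - v')" by (simp add: algebra_simps)
  then show ?thesis using assms by (simp add: two_sided_def)
qed

lemma two_sided_add:
  assumes "two_sided I" "u - u' \<in> I" "v - v' \<in> I"
  shows "(u + v) - (u' + v') \<in> I"
proof -
  have "(u + v) - (u' + v') = (u - u') + (v - v')" by (simp add: algebra_simps)
  with assms show ?thesis unfolding two_sided_def by metis
qed

text \<open>A complex algebra structure, encoded as a unital ring homomorphism from the complex
  numbers into the centre.\<close>

locale scalars =
  fixes \<sigma> :: "complex \<Rightarrow> 'a::ring_1"
  assumes \<sigma>_add: "\<sigma> (a + b) = \<sigma> a + \<sigma> b"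
    and \<sigma>_mult: "\<sigma> (a * b) = \<sigma> a * \<sigma> b"
    and \<sigma>_1: "\<sigma> 1 = 1"
    and \<sigma>_comm: "\<sigma> c * u = u * \<sigma> c"
begin

lemma \<sigma>_0: "\<sigma> 0 = 0"
  using \<sigma>_add[of 0 0] by simp

lemma \<sigma>_left_comm: "a * (\<sigma> c * b) = \<sigma> c * (a * b)"
  by (metis \<sigma>_comm mult.assoc)

definition pev :: "complex poly \<Rightarrow> 'a \<Rightarrow> 'a" where
  "pev p a = (\<Sum>i\<le>degree p. \<sigma> (coeff p i) * a ^ i)"

lemma pev_0 [simp]: "pev 0 a = 0"
  by (simp add: pev_def \<sigma>_0)

lemma pev_pCons [simp]: "pev (pCons c p) a = \<sigma> c + a * pev p a"
proof (cases "p = 0")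
  case True
  then show ?thesis by (simp add: pev_def \<sigma>_0)
next
  case False
  have "pev (pCons c p) a = \<sigma> c + (\<Sum>i\<le>degree p. \<sigma> (coeff p i) * a ^ Suc i)"
    using False unfolding pev_def degree_pCons_eq[OF False] sum.atMost_Suc_shift by simp
  also have "(\<Sum>i\<le>degree p. \<sigma> (coeff p i) * a ^ Suc i) = a * pev p a"
    unfolding pev_def sum_distrib_left
    by (intro sum.cong) (simp_all add: \<sigma>_left_comm)
  finally show ?thesis .
qed

lemma pev_add: "pev (p + q) a = pev p a + pev q a"
  by (induction p q rule: poly_induct2) (simp_all add: \<sigma>_add algebra_simps)

lemma pev_smult: "pev (smult c p) a = \<sigma> c * pev p a"
  by (induction p) (simp_all add: \<sigma>_mult distrib_left \<sigma>_left_comm)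

lemma pev_mult: "pev (p * q) a = pev p a * pev q a"
proof (induction p)
  case (pCons c p)
  then show ?case
    by (simp add: pev_add pev_smult algebra_simps \<sigma>_0)
qed simp

lemma pev_pcompose: "pev (pcompose p q) a = pev p (pev q a)"
  by (induction p) (simp_all add: pcompose_pCons pev_add pev_mult \<sigma>_0)

lemma pev_uminus: "pev (- p) a = - pev p a"
  using pev_add[of "- p" p a] by (simp add: eq_neg_iff_add_eq_0)

lemma pev_diff: "pev (p - q) a = pev p a - pev q a"
  using pev_add[of p "- q" a] by (simp add: pev_uminus)

lemma pev_X: "pev [:0, 1:] a = a"
  by (simp add: \<sigma>_0 \<sigma>_1)

lemma pev_1: "pev 1 a = 1"
  by (simp add: one_pCons \<sigma>_1 del: pCons_one)

text \<open>Horner's recursion carries the twisted commutation from \<open>a\<close> to polynomials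
  in \<open>a\<close>. Working modulo an ideal makes this available in the free algebra
  itself.\<close>

lemma pev_intertwine_mod:
  assumes I: "two_sided I" and "a * b - b * pev f a \<in> I"
  shows "pev p a * b - b * pev (pcompose p f) a \<in> I"
proof (induction p)
  case 0
  then show ?case using I by (simp add: two_sided_def)
next
  case (pCons c p)
  have "\<sigma> c * b = b * \<sigma> c" by (rule \<sigma>_comm)
  then have "pev (pCons c p) a * b - b * pev (pcompose (pCons c p) f) a =
      a * (pev p a * b - b * pev (pcompose p f) a) + (a * b - b * pev f a) * pev (pcompose p f) a"
    by (simp add: pcompose_pCons pev_add pev_mult \<sigma>_0 algebra_simps)
  then show ?case using I assms(2) pCons by (auto simp: two_sided_def)
qed

lemma pev_intertwine_mod':
  assumes I: "two_sided I" and "b * a - pev f a * b \<in> I"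
  shows "b * pev p a - pev (pcompose p f) a * b \<in> I"
proof (induction p)
  case 0
  then show ?case using I by (simp add: two_sided_def)
next
  case (pCons c p)
  have "\<sigma> c * b = b * \<sigma> c" by (rule \<sigma>_comm)
  then have "b * pev (pCons c p) a - pev (pcompose (pCons c p) f) a * b =
      pev f a * (b * pev p a - pev (pcompose p f) a * b) + (b * a - pev f a * b) * pev p a"
    by (simp add: pcompose_pCons pev_add pev_mult \<sigma>_0 algebra_simps)
  then show ?case using I assms(2) pCons by (auto simp: two_sided_def)
qed

lemma alg_hom_power: "alg_hom \<sigma> T \<Longrightarrow> T (u ^ n) = T u ^ n"
  by (induction n) (simp_all add: alg_hom_mult alg_hom_scal[of \<sigma> T 1, unfolded scal_1] \<sigma>_1)

lemma alg_hom_f_at_h: "alg_hom \<sigma> T \<Longrightarrow> T (f_at_h p) = pev p (T hv)"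
  by (simp add: f_at_h_def pev_def alg_hom_sum alg_hom_mult alg_hom_scal alg_hom_power)

text \<open>Existence half of the universal property of the free algebra, completed by
  \<open>alg_hom_eval\<close> and \<open>eval_gens\<close>.\<close>

definition eval :: "(gen \<Rightarrow> 'a) \<Rightarrow> freealg \<Rightarrow> 'a" where
  "eval G u = (\<Sum>w\<in>Poly_Mapping.keys u. \<sigma> (Poly_Mapping.lookup u w) * (case w of Word l \<Rightarrow> prod_list (map G l)))"

lemma eval_add: "eval G (u + v) = eval G u + eval G v"
  unfolding eval_def
  by (rule setsum_keys_plus_distrib[where f="\<lambda>w c. \<sigma> c * (case w of Word l \<Rightarrow> prod_list (map G l))"])
    (simp_all add: \<sigma>_0 \<sigma>_add distrib_right)

lemma eval_single: "eval G (Poly_Mapping.single (Word l) c) = \<sigma> c * prod_list (map G l)"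
  by (cases "c = 0") (simp_all add: eval_def \<sigma>_0)

lemma eval_0: "eval G 0 = 0"
  by (simp add: eval_def)

lemma eval_mult: "eval G (u * v) = eval G u * eval G v"
proof -
  have 1: "eval G (Poly_Mapping.single w c * Poly_Mapping.single w' c') =
      eval G (Poly_Mapping.single w c) * eval G (Poly_Mapping.single w' c')" for w w' c c'
  proof -
    obtain l l' where w: "w = Word l" "w' = Word l'" by (cases w; cases w') blast
    have "\<sigma> c * \<sigma> c' * (A * B) = \<sigma> c * A * (\<sigma> c' * B)" for A B
      using \<sigma>_left_comm[of A c' B] by (simp add: mult.assoc)
    then show ?thesis
      by (simp add: w mult_single eval_single \<sigma>_mult)
  qed
  have 2: "eval G (Poly_Mapping.single w c * v) = eval G (Poly_Mapping.single w c) * eval G v" for w c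
    by (induction v rule: poly_mapping_single_induct)
      (simp_all add: eval_0 eval_add distrib_left 1)
  show ?thesis
    by (induction u rule: poly_mapping_single_induct)
      (simp_all add: eval_0 eval_add distrib_right 2)
qed

lemma alg_hom_eval: "alg_hom \<sigma> (eval G)"
  using eval_single[of G "[]"] by (simp add: alg_hom_def eval_add eval_mult scal_def)

lemma eval_gens: "eval G xv = G Xg" "eval G yv = G Yg" "eval G hv = G Hg"
  by (simp_all add: xv_def yv_def hv_def eval_single \<sigma>_1)

end

interpretation F: scalars scal
  by unfold_locales (rule scal_add scal_mult scal_1 scal_comm)+

lemma f_at_h_eq: "f_at_h p = F.pev p hv"
  by (simp add: f_at_h_def F.pev_def)

subsection \<open>The Poincare-Birkhoff-Witt representation\<close>

text \<open>Iterates enter because \<open>h x^n = x^n g(h)\<close> with \<open>g = iter f n\<close>,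
  and likewise \<open>y^n h = g(h) y^n\<close>.\<close>

primrec iter :: "complex poly \<Rightarrow> nat \<Rightarrow> complex poly" where
  "iter f 0 = [:0, 1:]"
| "iter f (Suc n) = pcompose (iter f n) f"

lemma pcompose_X [simp]: "pcompose [:0, 1:] p = (p :: 'a::comm_semiring_1 poly)"
  by (simp add: pcompose_pCons)

lemma pcompose_X_right [simp]: "pcompose p [:0, 1:] = (p :: 'a::comm_semiring_1 poly)"
  by (induction p) (simp_all add: pcompose_pCons)

lemma pcompose_iter: "pcompose f (iter f n) = iter f (Suc n)"
  by (induction n) (simp_all add: pcompose_assoc)

lemma degree_iter: "degree (iter f n) = degree f ^ n"
  by (induction n) (simp_all add: degree_pcompose)

text \<open>Families of infinite support are allowed, so operators carry no finiteness condition;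
  \<open>bounded\<close> enters only with normal forms.\<close>

type_synonym pbw = "nat \<Rightarrow> nat \<Rightarrow> complex poly"

definition psc :: "complex \<Rightarrow> pbw \<Rightarrow> pbw" where
  "psc c w = (\<lambda>i k. smult c (w i k))"

lemma psc_apply [simp]: "psc c w i k = smult c (w i k)"
  by (simp add: psc_def)

text \<open>Operators on \<^typ>\<open>pbw\<close> model the left regular representation: \<^term>\<open>w i k\<close> is the
  coefficient \<open>p\<close> of \<open>x\<^sup>i p(h) y\<^sup>k\<close>.\<close>
typedef opr = "{T :: pbw \<Rightarrow> pbw. (\<forall>v w. T (v + w) = T v + T w) \<and> (\<forall>c w. T (psc c w) = psc c (T w))}"
  morphisms app Opr
  by (intro exI[of _ id]) simp

lemma app_add: "app T (v + w) = app T v + app T w"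
  and app_psc: "app T (psc c w) = psc c (app T w)"
  using app by blast+

lemma app_Opr:
  "(\<And>v w i k. T (v + w) i k = T v i k + T w i k) \<Longrightarrow> (\<And>c w i k. T (psc c w) i k = smult c (T w i k)) \<Longrightarrow>
    app (Opr T) = T"
  by (intro Opr_inverse) (auto simp: fun_eq_iff)

lemma app_zero [simp]: "app T 0 = 0"
  using app_add[of T 0 0] by simp

lemma app_diff: "app T (v - w) = app T v - app T w"
  using app_add[of T "v - w" w] by simp

lemma opr_eqI: "(\<And>w. app S w = app T w) \<Longrightarrow> S = T"
  by (metis app_inject ext)

instantiation opr :: ring_1
begin
definition "0 = Opr (\<lambda>_. 0)"
definition "1 = Opr (\<lambda>w. w)"
definition "S + T = Opr (\<lambda>w. app S w + app T w)"
definition "S - T = Opr (\<lambda>w. app S w - app T w)"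
definition "- T = Opr (\<lambda>w. - app T w)"
definition "S * T = Opr (\<lambda>w. app S (app T w))"

lemma app_ring [simp]:
  "app 0 w = 0" "app 1 w = w" "app (S + T) w = app S w + app T w"
  "app (S - T) w = app S w - app T w" "app (- T) w = - app T w"
  "app (S * T) w = app S (app T w)"
  unfolding zero_opr_def one_opr_def plus_opr_def minus_opr_def uminus_opr_def times_opr_def
  by (subst app_Opr; simp add: app_add app_psc smult_add_right smult_diff_right)+

instance
proof
  show "(0::opr) \<noteq> 1"
  proof
    assume "(0::opr) = 1"
    then have "app (0::opr) 1 = app 1 1" by simp
    then show False by simp
  qed
qed (auto intro!: opr_eqI simp: app_add app_diff algebra_simps)
end

lemma app_sum: "app (sum S A) w = (\<Sum>a\<in>A. app (S a) w)"
  by (induction A rule: infinite_finite_induct) simp_all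

lemma fun_sum_apply: "(sum g A :: 'b \<Rightarrow> 'c::comm_monoid_add) i = (\<Sum>a\<in>A. g a i)"
  by (induction A rule: infinite_finite_induct) simp_all

definition osc :: "complex \<Rightarrow> opr" where
  "osc c = Opr (psc c)"

lemma app_osc [simp]: "app (osc c) w = psc c w"
  unfolding osc_def by (subst app_Opr) (simp_all add: smult_add_right mult.commute)

interpretation O: scalars osc
  by unfold_locales
    (auto intro!: opr_eqI simp: app_psc, auto simp: fun_eq_iff smult_add_left mult.commute)

definition opX :: opr where
  "opX = Opr (\<lambda>w i k. case i of 0 \<Rightarrow> 0 | Suc j \<Rightarrow> w j k)"

definition opH :: "complex poly \<Rightarrow> opr" where
  "opH f = Opr (\<lambda>w i k. iter f i * w i k)"

text \<open>The formula comes from \<open>y x^(i+1) = x^(i+1) y + x^i (g(h) - h)\<close> with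
  \<open>g = iter f (Suc i)\<close>: moving \<open>y\<close> past one \<open>x\<close> at a time
  leaves terms that telescope. Once past \<open>x\<close>, \<open>y\<close> turns
  \<open>p(h)\<close> into \<open>p(f(h))\<close>.\<close>

definition opY :: "complex poly \<Rightarrow> opr" where
  "opY f = Opr (\<lambda>w i k. (case k of 0 \<Rightarrow> 0 | Suc l \<Rightarrow> pcompose (w i l) f) +
      (iter f (Suc i) - [:0, 1:]) * w (Suc i) k)"

lemma app_opX: "app opX w i k = (case i of 0 \<Rightarrow> 0 | Suc j \<Rightarrow> w j k)"
  unfolding opX_def by (subst app_Opr) (auto split: nat.splits)

lemma app_opH: "app (opH f) w i k = iter f i * w i k"
  unfolding opH_def by (subst app_Opr) (auto simp: distrib_left)

lemma app_opY: "app (opY f) w i k = (case k of 0 \<Rightarrow> 0 | Suc l \<Rightarrow> pcompose (w i l) f) +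
      (iter f (Suc i) - [:0, 1:]) * w (Suc i) k"
  unfolding opY_def
  by (subst app_Opr)
    (auto simp: distrib_left smult_add_right pcompose_add pcompose_smult smult_diff_right algebra_simps simp del: iter.simps
      split: nat.splits)

lemma app_pev_opH: "app (O.pev p (opH f)) w i k = pcompose p (iter f i) * w i k"
  by (induction p) (simp_all add: app_opH  pcompose_pCons algebra_simps)

lemma opH_opX: "opH f * opX = opX * O.pev f (opH f)"
  by (rule opr_eqI, intro ext)
    (simp add: app_opH app_opX app_pev_opH pcompose_iter del: iter.simps split: nat.splits)

lemma opY_opH: "opY f * opH f = O.pev f (opH f) * opY f"
  by (rule opr_eqI, intro ext)
    (simp add: app_opH app_opY app_pev_opH pcompose_iter pcompose_mult algebra_simps split: nat.splits)

lemma opY_opX: "opY f * opX - opX * opY f = O.pev f (opH f) - opH f"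
  by (rule opr_eqI, intro ext)
    (simp add: app_opH app_opY app_opX app_pev_opH pcompose_iter algebra_simps split: nat.splits)

definition rep :: "complex poly \<Rightarrow> freealg \<Rightarrow> opr" where
  "rep f = O.eval (\<lambda>g. case g of Xg \<Rightarrow> opX | Yg \<Rightarrow> opY f | Hg \<Rightarrow> opH f)"

lemma alg_hom_rep: "alg_hom osc (rep f)"
  by (simp add: rep_def O.alg_hom_eval)

lemma rep_gens [simp]: "rep f xv = opX" "rep f yv = opY f" "rep f hv = opH f"
  by (simp_all add: rep_def O.eval_gens)

lemma rep_simps [simp]:
  "rep f (u + v) = rep f u + rep f v" "rep f (u - v) = rep f u - rep f v"
  "rep f (u * v) = rep f u * rep f v" "rep f 0 = 0" "rep f (scal c) = osc c"
  "rep f (u ^ n) = rep f u ^ n" "rep f (f_at_h p) = O.pev p (opH f)"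
  "rep f (sum g A) = (\<Sum>a\<in>A. rep f (g a))"
  using alg_hom_rep[of f]
  by (simp_all add: alg_hom_add alg_hom_diff alg_hom_mult alg_hom_zero alg_hom_scal O.alg_hom_power
      O.alg_hom_f_at_h alg_hom_sum)

lemma rep_pev [simp]: "rep f (F.pev p hv) = O.pev p (opH f)"
  using rep_simps(7)[of f p] by (simp add: f_at_h_eq)

subsection \<open>The ideal of relations\<close>

lemma ring_FreeR: "ring FreeR"
proof (rule ringI)
  show "abelian_group FreeR"
    by (rule abelian_groupI) (auto simp: FreeR_def add.assoc add.commute intro: exI[of _ "- x" for x])
  show "Group.monoid FreeR"
    by (rule monoidI) (auto simp: FreeR_def mult.assoc)
qed (auto simp: FreeR_def distrib_left distrib_right)

lemma FreeR_simps: "carrier FreeR = UNIV" "u \<oplus>\<^bsub>FreeR\<^esub> v = u + v" "u \<otimes>\<^bsub>FreeR\<^esub> v = u * v"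
  "\<zero>\<^bsub>FreeR\<^esub> = 0" "\<one>\<^bsub>FreeR\<^esub> = 1"
  by (simp_all add: FreeR_def)

text \<open>Bridge from ideals of the record \<open>FreeR\<close> to the type-class ring in which
  all calculations take place.\<close>

lemma ideal_FreeR_iff: "ideal I FreeR \<longleftrightarrow> two_sided I"
proof
  assume "ideal I FreeR"
  then interpret ideal I FreeR .
  show "two_sided I"
    using additive_subgroup.zero_closed[OF is_additive_subgroup]
      additive_subgroup.a_closed[OF is_additive_subgroup] I_l_closed I_r_closed
    unfolding two_sided_def FreeR_simps by auto
next
  assume I: "two_sided I"
  interpret ring FreeR by (rule ring_FreeR)
  show "ideal I FreeR"
  proof (rule idealI[OF ring_FreeR])
    show "subgroup I (add_monoid FreeR)"
    proof (rule add.subgroupI)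
      fix u assume "u \<in> I"
      moreover have "\<ominus>\<^bsub>FreeR\<^esub> u = - u"
        by (rule minus_equality) (simp_all add: FreeR_simps)
      ultimately show "\<ominus>\<^bsub>FreeR\<^esub> u \<in> I" using two_sided_uminus[OF I] by simp
    qed (use I in \<open>auto simp: two_sided_def FreeR_simps\<close>)
  qed (use I in \<open>auto simp: two_sided_def FreeR_simps\<close>)
qed

lemma two_sided_relideal: "two_sided (relideal f)"
  unfolding ideal_FreeR_iff[symmetric] relideal_def
  by (rule ring.genideal_ideal[OF ring_FreeR]) (simp add: FreeR_simps)

lemma relideal_rels:
  "hv * xv - xv * f_at_h f \<in> relideal f"
  "yv * hv - f_at_h f * yv \<in> relideal f"
  "(yv * xv - xv * yv) - (f_at_h f - hv) \<in> relideal f"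
  using ring.genideal_self[OF ring_FreeR, of "rels f"]
  by (auto simp: relideal_def rels_def FreeR_simps)

lemma relideal_minimal: "two_sided I \<Longrightarrow> rels f \<subseteq> I \<Longrightarrow> relideal f \<subseteq> I"
  unfolding relideal_def ideal_FreeR_iff[symmetric]
  by (rule ring.genideal_minimal[OF ring_FreeR])

lemma two_sided_kernel: "alg_hom \<sigma> T \<Longrightarrow> two_sided {u. T u = 0}"
  by (simp add: two_sided_def alg_hom_zero alg_hom_add alg_hom_mult)

lemma rep_relideal: "u \<in> relideal f \<Longrightarrow> rep f u = 0"
  using relideal_minimal[OF two_sided_kernel[OF alg_hom_rep[of f]], of f]
  by (auto simp: rels_def opH_opX opY_opH opY_opX)

lemma rep_cong: "u - v \<in> relideal f \<Longrightarrow> rep f u = rep f v"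
  using rep_relideal[of "u - v" f] by simp

definition cg :: "complex poly \<Rightarrow> freealg \<Rightarrow> freealg \<Rightarrow> bool" where
  "cg f u v \<longleftrightarrow> u - v \<in> relideal f"

lemma cg_refl: "cg f u u"
  using two_sided_relideal[of f] by (simp add: cg_def two_sided_def)

lemma cg_trans [trans]: "cg f u v \<Longrightarrow> cg f v w \<Longrightarrow> cg f u w"
  unfolding cg_def by (rule two_sided_trans[OF two_sided_relideal])

lemma cg_sym: "cg f u v \<Longrightarrow> cg f v u"
  unfolding cg_def by (rule two_sided_sym[OF two_sided_relideal])

lemma cg_add: "cg f u u' \<Longrightarrow> cg f v v' \<Longrightarrow> cg f (u + v) (u' + v')"
  unfolding cg_def by (rule two_sided_add[OF two_sided_relideal])

lemma cg_mult: "cg f u u' \<Longrightarrow> cg f v v' \<Longrightarrow> cg f (u * v) (u' * v')"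
  unfolding cg_def by (rule two_sided_mult[OF two_sided_relideal])

lemma cg_rels:
  "cg f (hv * xv) (xv * F.pev f hv)"
  "cg f (yv * hv) (F.pev f hv * yv)"
  "cg f (yv * xv) (xv * yv + F.pev (f - [:0, 1:]) hv)"
  using relideal_rels[of f] unfolding cg_def F.pev_diff F.pev_X f_at_h_eq
  by (simp_all add: algebra_simps)

section \<open>Spanning by the monomials \<open>x^i p(h) y^k\<close>\<close>

definition mon :: "nat \<Rightarrow> complex poly \<Rightarrow> nat \<Rightarrow> freealg" where
  "mon i p k = xv ^ i * F.pev p hv * yv ^ k"

lemma mon_0 [simp]: "mon i 0 k = 0"
  by (simp add: mon_def)

lemma mon_add: "mon i (p + q) k = mon i p k + mon i q k"
  by (simp add: mon_def F.pev_add distrib_left distrib_right)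

lemma scal_mon: "scal c * mon i p k = mon i (smult c p) k"
  by (simp add: mon_def F.pev_smult F.\<sigma>_left_comm mult.assoc)

lemma x_mon: "xv * mon i p k = mon (Suc i) p k"
  by (simp add: mon_def mult.assoc)

lemma pev_x_power: "cg f (F.pev q hv * xv ^ i) (xv ^ i * F.pev (pcompose q (iter f i)) hv)"
proof (induction i)
  case 0
  then show ?case by (simp add: cg_refl)
next
  case (Suc i)
  have "cg f (F.pev q hv * xv ^ i * xv) (xv ^ i * F.pev (pcompose q (iter f i)) hv * xv)"
    by (intro cg_mult Suc cg_refl)
  also have "cg f (F.pev (pcompose q (iter f i)) hv * xv)
      (xv * F.pev (pcompose (pcompose q (iter f i)) f) hv)"
    using cg_rels(1)[of f] unfolding cg_def
    by (rule F.pev_intertwine_mod[OF two_sided_relideal])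
  then have "cg f (xv ^ i * F.pev (pcompose q (iter f i)) hv * xv)
      (xv ^ i * (xv * F.pev (pcompose q (iter f (Suc i))) hv))"
    unfolding mult.assoc[of "xv ^ i"] by (intro cg_mult[OF cg_refl]) (simp add: pcompose_assoc)
  finally show ?case
    by (simp only: power_Suc2 mult.assoc)
qed

lemma pev_mon: "cg f (F.pev q hv * mon i p k) (mon i (pcompose q (iter f i) * p) k)"
  unfolding mon_def F.pev_mult
  using cg_mult[OF pev_x_power cg_refl, of f q i "F.pev p hv * yv ^ k"] by (simp add: mult.assoc)

lemma y_mon_0: "cg f (yv * mon 0 p k) (mon 0 (pcompose p f) (Suc k))"
proof -
  have "cg f (yv * F.pev p hv) (F.pev (pcompose p f) hv * yv)"
    using cg_rels(2)[of f] unfolding cg_def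
    by (rule F.pev_intertwine_mod'[OF two_sided_relideal])
  from cg_mult[OF this cg_refl, of "yv ^ k"] show ?thesis
    by (simp add: mon_def mult.assoc)
qed

lemma y_mon_Suc:
  "cg f (yv * mon (Suc i) p k) (xv * (yv * mon i p k) + F.pev (f - [:0, 1:]) hv * mon i p k)"
  using cg_mult[OF cg_rels(3) cg_refl, of f "mon i p k"]
  by (simp add: x_mon[symmetric] mult.assoc distrib_right)

definition bounded :: "pbw \<Rightarrow> nat \<Rightarrow> bool" where
  "bounded w N \<longleftrightarrow> (\<forall>i k. N \<le> i \<or> N \<le> k \<longrightarrow> w i k = 0)"

text \<open>The square of side \<open>N\<close> is only a common bound for the support; by
  \<open>assemble_mono\<close> it may be enlarged, as needed for adding two normal forms.\<close>

definition assemble :: "nat \<Rightarrow> pbw \<Rightarrow> freealg" where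
  "assemble N w = (\<Sum>(i,k)\<in>{..<N} \<times> {..<N}. mon i (w i k) k)"

definition delta :: "nat \<Rightarrow> complex poly \<Rightarrow> nat \<Rightarrow> pbw" where
  "delta i p k = (\<lambda>i' k'. if i' = i \<and> k' = k then p else 0)"

lemma assemble_mono: "bounded w N \<Longrightarrow> N \<le> M \<Longrightarrow> assemble M w = assemble N w"
  unfolding assemble_def
  by (rule sum.mono_neutral_right) (auto simp: bounded_def, (metis mon_0 not_le)+)

lemma assemble_add: "assemble N (v + w) = assemble N v + assemble N w"
  by (simp add: assemble_def mon_add sum.distrib case_prod_beta)

lemma assemble_delta: "i < N \<Longrightarrow> k < N \<Longrightarrow> assemble N (delta i p k) = mon i p k"
  unfolding assemble_def
  by (subst sum.mono_neutral_right[of _ "{(i, k)}"]) (auto simp: delta_def split: if_splits)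

definition spanned :: "complex poly \<Rightarrow> freealg \<Rightarrow> bool" where
  "spanned f u \<longleftrightarrow> (\<exists>N w. bounded w N \<and> cg f u (assemble N w))"

lemma spanned_cg: "cg f u v \<Longrightarrow> spanned f v \<Longrightarrow> spanned f u"
  unfolding spanned_def using cg_trans by blast

lemma spanned_add: assumes "spanned f u" "spanned f v" shows "spanned f (u + v)"
proof -
  obtain N v1 M v2 where *: "bounded v1 N" "cg f u (assemble N v1)"
      "bounded v2 M" "cg f v (assemble M v2)"
    using assms unfolding spanned_def by blast
  let ?K = "max N M"
  have "bounded (v1 + v2) ?K" using * by (auto simp: bounded_def)
  moreover have "cg f (u + v) (assemble ?K (v1 + v2))"
    using cg_add[OF *(2,4)] assemble_mono[OF *(1), of ?K] assemble_mono[OF *(3), of ?K]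
    by (simp add: assemble_add)
  ultimately show ?thesis unfolding spanned_def by blast
qed

lemma spanned_mon: "spanned f (mon i p k)"
proof -
  let ?N = "Suc (max i k)"
  have "bounded (delta i p k) ?N" by (auto simp: bounded_def delta_def)
  then show ?thesis
    unfolding spanned_def using assemble_delta[of i ?N k p] cg_refl
    by (metis lessI less_Suc_eq_le max.cobounded1 max.cobounded2)
qed

lemma spanned_sum: "(\<And>a. a \<in> A \<Longrightarrow> spanned f (g a)) \<Longrightarrow> spanned f (sum g A)"
  by (induction A rule: infinite_finite_induct)
    (auto intro: spanned_add spanned_mon[of f 0 0 0, simplified])

lemma spanned_mult_left:
  assumes "spanned f u" and "\<And>i p k. spanned f (a * mon i p k)"
  shows "spanned f (a * u)"
proof -
  obtain N w where w: "cg f u (assemble N w)"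
    using assms(1) unfolding spanned_def by blast
  show ?thesis
    by (rule spanned_cg[OF cg_mult[OF cg_refl w]])
      (auto simp: assemble_def sum_distrib_left case_prod_beta intro!: spanned_sum assms(2))
qed

lemma spanned_x: "spanned f u \<Longrightarrow> spanned f (xv * u)"
  by (erule spanned_mult_left) (simp add: x_mon spanned_mon)

text \<open>Each use of the third relation moves \<open>y\<close> past one \<open>x\<close> and
  leaves a correction with a smaller power of \<open>x\<close>; hence induction on
  \<open>i\<close>.\<close>

lemma spanned_y_mon: "spanned f (yv * mon i p k)"
proof (induction i)
  case 0
  show ?case by (rule spanned_cg[OF y_mon_0 spanned_mon])
next
  case (Suc i)
  show ?case
    by (rule spanned_cg[OF y_mon_Suc]) (intro spanned_add spanned_x Suc spanned_cg[OF pev_mon spanned_mon])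
qed

text \<open>The span is stable under left multiplication by scalars and generators, so it is a left
  ideal; as it contains 1, it is everything.\<close>

lemma spanned_mult: "spanned f v \<Longrightarrow> spanned f (u * v)"
proof (induction u arbitrary: v rule: freealg_induct)
  case (scal c)
  then show ?case by (rule spanned_mult_left) (simp add: scal_mon spanned_mon)
next
  case x
  then show ?case by (rule spanned_x)
next
  case y
  then show ?case by (rule spanned_mult_left) (rule spanned_y_mon)
next
  case h
  then show ?case
    using spanned_cg[OF pev_mon spanned_mon, of f "[:0, 1:]"]
    by (elim spanned_mult_left) (simp only: F.pev_X)
qed (simp_all add: distrib_right spanned_add mult.assoc)

lemma spanned_all: "spanned f u"
  using spanned_mult[OF spanned_mon, of f u 0 1 0] by (simp add: mon_def F.pev_1)

section \<open>Linear independence of the monomials and faithfulness of the representation\<close>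

definition co :: "opr \<Rightarrow> pbw" where
  "co A = app A (delta 0 1 0)"

definition omon :: "complex poly \<Rightarrow> nat \<Rightarrow> complex poly \<Rightarrow> nat \<Rightarrow> opr" where
  "omon f i p k = opX ^ i * O.pev p (opH f) * opY f ^ k"

lemma rep_mon [simp]: "rep f (mon i p k) = omon f i p k"
  by (simp add: mon_def omon_def)

lemma opY_power_delta: "app (opY f ^ k) (delta 0 1 0) = delta 0 1 k"
proof (induction k)
  case (Suc k)
  have "app (opY f) (delta 0 1 k) = delta 0 1 (Suc k)"
    by (intro ext) (auto simp: app_opY delta_def pcompose_1 split: nat.splits)
  then show ?case using Suc by simp
qed simp

lemma opX_power_delta: "app (opX ^ i) (delta 0 p k) = delta i p k"
proof (induction i)
  case (Suc i)
  have "app opX (delta i p k) = delta (Suc i) p k"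
    by (intro ext) (auto simp: app_opX delta_def split: nat.splits)
  then show ?case using Suc by simp
qed simp

text \<open>The family \<open>delta 0 1 0\<close> represents 1, so applying the operator of a
  monomial to it returns that monomial's own coordinates.\<close>

lemma co_omon: "co (omon f i p k) = delta i p k"
proof -
  have "app (O.pev p (opH f)) (delta 0 1 k) = delta 0 p k"
    by (intro ext) (auto simp: app_pev_opH delta_def)
  then show ?thesis
    by (simp add: co_def omon_def opY_power_delta opX_power_delta)
qed

lemma co_pev_opH: "co (O.pev p (opH f)) = delta 0 p 0"
  using co_omon[of f 0 p 0] by (simp add: omon_def)

lemma co_simps [simp]: "co (A + B) = co A + co B" "co (A - B) = co A - co B" "co 0 = 0"
  by (simp_all add: co_def)

lemma rep_assemble: "rep f (assemble N w) = (\<Sum>(i,k)\<in>{..<N} \<times> {..<N}. omon f i (w i k) k)"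
  by (simp add: assemble_def case_prod_beta)

lemma co_assemble: "bounded w N \<Longrightarrow> co (rep f (assemble N w)) = w"
proof (intro ext)
  fix i k assume w: "bounded w N"
  have "co (rep f (assemble N w)) i k = (\<Sum>(i',k')\<in>{..<N} \<times> {..<N}. delta i' (w i' k') k' i k)"
    by (simp add: rep_assemble co_def app_sum fun_sum_apply case_prod_beta)
      (simp add: co_def[symmetric] co_omon)
  also have "\<dots> = w i k"
  proof (cases "i < N \<and> k < N")
    case True
    then show ?thesis
      by (subst sum.mono_neutral_right[of _ "{(i, k)}"]) (auto simp: delta_def split: if_splits)
  next
    case False
    then have "w i k = 0" using w by (auto simp: bounded_def)
    then show ?thesis by (subst sum.neutral) (auto simp: delta_def)
  qed
  finally show "co (rep f (assemble N w)) i k = w i k" .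
qed

lemma normal_form:
  obtains N where "bounded (co (rep f u)) N" "cg f u (assemble N (co (rep f u)))"
proof -
  obtain N w where w: "bounded w N" "cg f u (assemble N w)"
    using spanned_all[of f u] unfolding spanned_def by blast
  then have "rep f u = rep f (assemble N w)"
    by (intro rep_cong) (simp add: cg_def)
  then have "co (rep f u) = w" using co_assemble[OF w(1)] by simp
  with that w show thesis by blast
qed

lemma relideal_iff_co: "u \<in> relideal f \<longleftrightarrow> co (rep f u) = 0"
proof
  assume "co (rep f u) = 0"
  moreover obtain N where "cg f u (assemble N (co (rep f u)))" by (rule normal_form)
  ultimately show "u \<in> relideal f" by (simp add: cg_def assemble_def)
qed (simp add: rep_relideal)

text \<open>From here on \<open>range (rep f)\<close> serves as a concrete model of the algebra, and
  elements are compared through their coefficient families.\<close>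

lemma relideal_iff_rep: "u \<in> relideal f \<longleftrightarrow> rep f u = 0"
  using relideal_iff_co rep_relideal by auto

lemma rep_normal_form:
  obtains N where "bounded (co (rep f u)) N"
    "rep f u = (\<Sum>(i,k)\<in>{..<N} \<times> {..<N}. omon f i (co (rep f u) i k) k)"
proof -
  obtain N where N: "bounded (co (rep f u)) N" "cg f u (assemble N (co (rep f u)))"
    by (rule normal_form)
  then have "rep f u = rep f (assemble N (co (rep f u)))"
    by (intro rep_cong) (simp add: cg_def)
  then show thesis using that[OF N(1)] unfolding rep_assemble by blast
qed

lemma co_eq_0: "A \<in> range (rep f) \<Longrightarrow> co A = 0 \<Longrightarrow> A = 0"
  using relideal_iff_co rep_relideal by blast

lemma range_rep_diff: "A \<in> range (rep f) \<Longrightarrow> B \<in> range (rep f) \<Longrightarrow> A - B \<in> range (rep f)"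
  by (elim rangeE) (simp only: rep_simps(2)[symmetric] rangeI)

lemma range_rep_mult: "A \<in> range (rep f) \<Longrightarrow> B \<in> range (rep f) \<Longrightarrow> A * B \<in> range (rep f)"
  by (elim rangeE) (simp only: rep_simps(3)[symmetric] rangeI)

lemma range_rep_pev: "O.pev p (opH f) \<in> range (rep f)"
  by (metis rangeI rep_pev)

lemma co_inject:
  "A \<in> range (rep f) \<Longrightarrow> B \<in> range (rep f) \<Longrightarrow> co A = co B \<Longrightarrow> A = B"
  using co_eq_0[OF range_rep_diff, of A f B] by simp

subsection \<open>Leading terms\<close>

text \<open>The order compares the power of \<open>y\<close> first, then that of \<open>x\<close>.
  The coefficient at \<open>(I,K)\<close> itself may vanish; only \<open>lead\<close> forbids
  that.\<close>

definition below :: "pbw \<Rightarrow> nat \<Rightarrow> nat \<Rightarrow> bool" where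
  "below w I K \<longleftrightarrow> (\<forall>i k. K < k \<or> (k = K \<and> I < i) \<longrightarrow> w i k = 0)"

definition lead :: "pbw \<Rightarrow> nat \<Rightarrow> nat \<Rightarrow> bool" where
  "lead w I K \<longleftrightarrow> below w I K \<and> w I K \<noteq> 0"

lemma lead_unique: "lead w I K \<Longrightarrow> lead w I' K' \<Longrightarrow> I = I' \<and> K = K'"
  unfolding lead_def below_def by (metis nat_neq_iff)

lemma ex_lead: assumes "bounded w N" "w \<noteq> 0" shows "\<exists>I K. lead w I K"
proof -
  define P where "P = (\<lambda>k. \<exists>i. w i k \<noteq> 0)"
  obtain i0 k0 where "w i0 k0 \<noteq> 0" using assms(2) by (force simp: fun_eq_iff)
  then have P: "P k0" by (auto simp: P_def)
  have bP: "\<And>k. P k \<Longrightarrow> k \<le> N" using assms(1) unfolding P_def bounded_def by (metis nat_le_linear)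
  define K where "K = (GREATEST k. P k)"
  have "P K" unfolding K_def by (rule GreatestI_nat[where P = P, OF P]) (rule bP)
  then obtain i1 where i1: "w i1 K \<noteq> 0" by (auto simp: P_def)
  have bi: "\<And>i. w i K \<noteq> 0 \<Longrightarrow> i \<le> N" using assms(1) unfolding bounded_def by (metis nat_le_linear)
  define I where "I = (GREATEST i. w i K \<noteq> 0)"
  have "w I K \<noteq> 0" unfolding I_def by (rule GreatestI_nat[of "\<lambda>i. w i K \<noteq> 0", OF i1]) (rule bi)
  moreover have "w i K = 0" if "I < i" for i
  proof (rule ccontr)
    assume "w i K \<noteq> 0"
    then have "i \<le> I" unfolding I_def by (rule Greatest_le_nat[of "\<lambda>i. w i K \<noteq> 0"]) (rule bi)
    with that show False by simp
  qed
  moreover have "w i k = 0" if "K < k" for i k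
  proof (rule ccontr)
    assume "w i k \<noteq> 0"
    then have "P k" by (auto simp: P_def)
    then have "k \<le> K" unfolding K_def by (rule Greatest_le_nat[where P = P]) (rule bP)
    with that show False by simp
  qed
  ultimately have "lead w I K" by (simp add: lead_def below_def)
  then show ?thesis by (intro exI)
qed

lemma ex_lead_rep: "A \<in> range (rep f) \<Longrightarrow> A \<noteq> 0 \<Longrightarrow> \<exists>I K. lead (co A) I K"
proof -
  assume A: "A \<in> range (rep f)" "A \<noteq> 0"
  then obtain u where u: "A = rep f u" by blast
  obtain N where "bounded (co (rep f u)) N" by (rule normal_form)
  moreover have "co (rep f u) \<noteq> 0" using A(2) co_eq_0[OF A(1)] by (auto simp: u)
  ultimately show ?thesis unfolding u by (rule ex_lead)
qed

lemma below_opY_power: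
  assumes "below w I K"
  shows "below (app (opY f ^ k) w) I (K + k) \<and>
    app (opY f ^ k) w I (K + k) = pcompose (w I K) (iter f k)"
proof (induction k)
  case (Suc k)
  then show ?case
    by (auto simp: below_def app_opY pcompose_assoc split: nat.splits)
qed (use assms in simp)

lemma below_opX_power:
  assumes "below w I K"
  shows "below (app (opX ^ i) w) (I + i) K \<and> app (opX ^ i) w (I + i) K = w I K"
proof (induction i)
  case (Suc i)
  then show ?case by (auto simp: below_def app_opX split: nat.splits)
qed (use assms in simp)

text \<open>The two compositions record moving \<open>p(h)\<close> across \<open>x^I\<close> and
  moving \<open>y^k\<close> across the coefficient \<open>w I K\<close>; the corrections from
  \<open>y^k\<close> passing \<open>x^I\<close> are of lower order.\<close>

lemma below_omon:
  assumes "below w I K"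
  shows "below (app (omon f i p k) w) (I + i) (K + k) \<and>
    app (omon f i p k) w (I + i) (K + k) = pcompose p (iter f I) * pcompose (w I K) (iter f k)"
proof -
  let ?v = "app (O.pev p (opH f)) (app (opY f ^ k) w)"
  have "below ?v I (K + k) \<and> ?v I (K + k) = pcompose p (iter f I) * pcompose (w I K) (iter f k)"
    using below_opY_power[OF assms, of f k] by (auto simp: below_def app_pev_opH)
  then show ?thesis
    using below_opX_power[of ?v I "K + k" i] by (simp add: omon_def)
qed

lemma omon_0 [simp]: "omon f i 0 k = 0"
  by (simp add: omon_def)

text \<open>Top coefficient of a product, for every \<open>f\<close>, constant ones included.
  Whether that coefficient is nonzero is settled separately in \<open>lead_mult\<close>.\<close>

lemma below_rep_app:
  assumes A: "A \<in> range (rep f)" and "below (co A) I K" and w: "below w I' K'"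
  shows "below (app A w) (I + I') (K + K')"
    and "app A w (I + I') (K + K') = pcompose (co A I K) (iter f I') * pcompose (w I' K') (iter f K)"
proof -
  define c where "c = co A"
  obtain u where u: "A = rep f u" using A by blast
  obtain N where N: "bounded c N" and A: "A = (\<Sum>(i,k)\<in>{..<N} \<times> {..<N}. omon f i (c i k) k)"
    using rep_normal_form[of f u] unfolding u c_def by blast
  have c: "below c I K" using assms(2) by (simp add: c_def)
  have app: "app A w m n = (\<Sum>(i,k)\<in>{..<N} \<times> {..<N}. app (omon f i (c i k) k) w m n)" for m n
    unfolding A by (simp add: app_sum fun_sum_apply case_prod_beta)
  \<comment> \<open>At or above the expected top position, the only possible contribution is that of
    the monomial \<open>(I,K)\<close> of \<open>A\<close>, at that position exactly.\<close>
  have zero: "app (omon f i (c i k) k) w m n = 0"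
    if "K + K' < n \<or> (n = K + K' \<and> I + I' \<le> m)" "(m, n, i, k) \<noteq> (I + I', K + K', I, K)" for i k m n
  proof (cases "K < k \<or> (k = K \<and> I < i)")
    case True
    then have "c i k = 0" using c unfolding below_def by blast
    then show ?thesis by simp
  next
    case False
    have "K' + k < n \<or> (n = K' + k \<and> I' + i < m)"
      using False that by auto
    then show ?thesis using below_omon[OF w, of f i "c i k" k] by (auto simp: below_def)
  qed
  show "below (app A w) (I + I') (K + K')"
    unfolding below_def app by (intro allI impI sum.neutral) (auto intro!: zero)
  have "app A w (I + I') (K + K') = app (omon f I (c I K) K) w (I + I') (K + K')"
  proof (cases "I < N \<and> K < N")
    case True
    then show ?thesis unfolding app
      by (subst sum.mono_neutral_right[of _ "{(I, K)}"]) (auto intro!: zero)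
  next
    case False
    then have "c I K = 0" using N by (auto simp: bounded_def)
    then have "app (omon f i (c i k) k) w (I + I') (K + K') = 0" for i k
      using zero[of "K + K'" "I + I'" i k] by (cases "i = I \<and> k = K") auto
    then show ?thesis unfolding app by (simp add: case_prod_beta)
  qed
  also have "\<dots> = pcompose (c I K) (iter f I') * pcompose (w I' K') (iter f K)"
    using below_omon[OF w, of f I "c I K" K] by (simp add: add.commute)
  finally show "app A w (I + I') (K + K') = pcompose (co A I K) (iter f I') * pcompose (w I' K') (iter f K)"
    by (simp add: c_def)
qed

lemma co_mult: "co (A * B) = app A (co B)"
  by (simp add: co_def)

lemma pcompose_iter_eq_0: "degree f \<ge> 1 \<Longrightarrow> pcompose p (iter f n) = 0 \<longleftrightarrow> p = 0"
  by (metis One_nat_def degree_iter pcompose_0 pcompose_eq_0 Suc_le_eq zero_less_power)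

text \<open>For nonconstant \<open>f\<close>, composition with an iterate kills no nonzero
  polynomial, so the product of the two top coefficients survives.\<close>

lemma lead_mult:
  assumes f: "degree f \<ge> 1" and A: "A \<in> range (rep f)" and "lead (co A) I K" and "lead (co B) I' K'"
  shows "lead (co (A * B)) (I + I') (K + K')"
    and "co (A * B) (I + I') (K + K') =
      pcompose (co A I K) (iter f I') * pcompose (co B I' K') (iter f K)"
  using below_rep_app[OF A, of I K "co B" I' K'] assms(3,4)
  by (simp_all add: lead_def co_mult pcompose_iter_eq_0[OF f])

lemma rep_no_zero_divisors:
  assumes "degree f \<ge> 1" "A \<in> range (rep f)" "B \<in> range (rep f)" "A * B = 0"
  shows "A = 0 \<or> B = 0"
proof (rule ccontr)
  assume "\<not> ?thesis"
  then obtain I K I' K' where "lead (co A) I K" "lead (co B) I' K'"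
    using ex_lead_rep assms(2,3) by meson
  from lead_mult(1)[OF assms(1,2) this] show False
    using assms(4) by (simp add: lead_def)
qed

lemma rep_eq_pev:
  assumes "A \<in> range (rep f)" "lead (co A) 0 0"
  shows "A = O.pev (co A 0 0) (opH f)"
proof (rule co_inject[OF assms(1) range_rep_pev])
  show "co A = co (O.pev (co A 0 0) (opH f))"
    using assms(2) unfolding co_pev_opH delta_def lead_def below_def
    by (intro ext) (metis neq0_conv)
qed

lemma lead_delta: "lead (delta 0 p 0) 0 0 \<longleftrightarrow> p \<noteq> 0"
  by (auto simp: lead_def below_def delta_def)

subsection \<open>Isomorphisms of the quotient algebras\<close>

definition quo :: "complex poly \<Rightarrow> freealg \<Rightarrow> freealg set" where
  "quo f u = relideal f +>\<^bsub>FreeR\<^esub> u"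

lemma ideal_relideal: "ideal (relideal f) FreeR"
  by (simp add: ideal_FreeR_iff two_sided_relideal)

lemma quo_eq_iff: "quo f u = quo f v \<longleftrightarrow> cg f u v"
proof -
  have mem: "w \<in> quo f u \<longleftrightarrow> cg f w u" for w u
    by (auto simp: quo_def a_r_coset_def' FreeR_simps cg_def) (metis diff_add_cancel)
  show ?thesis
    by (metis cg_refl cg_sym cg_trans mem subsetI subset_antisym)
qed

lemma quo_eq_iff_rep: "quo f u = quo f v \<longleftrightarrow> rep f u = rep f v"
  by (simp add: quo_eq_iff cg_def relideal_iff_rep)

lemma carrier_HAlg: "carrier (HAlg f) = range (quo f)"
  by (auto simp: HAlg_def FactRing_def A_RCOSETS_def' FreeR_simps quo_def)

lemma quo_hom: "quo f \<in> ring_hom FreeR (HAlg f)"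
  using ideal.rcos_ring_hom[OF ideal_relideal] by (simp add: HAlg_def quo_def[abs_def])

lemma HAlg_simps:
  "quo f u \<oplus>\<^bsub>HAlg f\<^esub> quo f v = quo f (u + v)"
  "quo f u \<otimes>\<^bsub>HAlg f\<^esub> quo f v = quo f (u * v)"
  "\<one>\<^bsub>HAlg f\<^esub> = quo f 1"
  using ring_hom_add[OF quo_hom] ring_hom_mult[OF quo_hom] ring_hom_one[OF quo_hom]
  by (simp_all add: FreeR_simps)

lemma ring_HAlg: "ring (HAlg f)"
  unfolding HAlg_def by (rule ideal.quotient_is_ring[OF ideal_relideal])

lemma alg_iso_sym: assumes "alg_iso f1 f2" shows "alg_iso f2 f1"
proof -
  obtain \<phi> where \<phi>: "\<phi> \<in> ring_iso (HAlg f1) (HAlg f2)" "\<And>c. \<phi> (quo f1 (scal c)) = quo f2 (scal c)"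
    using assms unfolding alg_iso_def quo_def by blast
  let ?\<psi> = "inv_into (carrier (HAlg f1)) \<phi>"
  have "?\<psi> \<in> ring_iso (HAlg f2) (HAlg f1)"
    by (rule ring_iso_set_sym[OF ring_HAlg \<phi>(1)])
  moreover have "?\<psi> (quo f2 (scal c)) = quo f1 (scal c)" for c
    using \<phi> by (intro inv_into_f_eq) (auto simp: ring_iso_def bij_betw_def carrier_HAlg)
  ultimately show ?thesis unfolding alg_iso_def quo_def by blast
qed

lemma alg_iso_trans: assumes "alg_iso f1 f2" "alg_iso f2 f3" shows "alg_iso f1 f3"
proof -
  obtain \<phi> \<psi> where *: "\<phi> \<in> ring_iso (HAlg f1) (HAlg f2)" "\<And>c. \<phi> (quo f1 (scal c)) = quo f2 (scal c)"
      "\<psi> \<in> ring_iso (HAlg f2) (HAlg f3)" "\<And>c. \<psi> (quo f2 (scal c)) = quo f3 (scal c)"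
    using assms unfolding alg_iso_def quo_def by blast
  have "\<psi> \<circ> \<phi> \<in> ring_iso (HAlg f1) (HAlg f3)"
    by (rule ring_iso_set_trans[OF *(1,3)])
  then show ?thesis
    unfolding alg_iso_def quo_def[symmetric] by (intro exI[of _ "\<psi> \<circ> \<phi>"]) (simp add: *)
qed

text \<open>Replaces a map between sets of cosets by a homomorphism from the free algebra to
  operators, with the kernel of \<open>rep f1\<close> and the image of
  \<open>rep f2\<close>.\<close>

lemma alg_iso_imp_hom:
  assumes "alg_iso f1 f2"
  obtains T where "alg_hom osc T" "\<And>u. T u = 0 \<longleftrightarrow> rep f1 u = 0" "range T = range (rep f2)"
proof -
  obtain \<phi> where iso: "\<phi> \<in> ring_iso (HAlg f1) (HAlg f2)"
    and sc: "\<And>c. \<phi> (quo f1 (scal c)) = quo f2 (scal c)"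
    using assms unfolding alg_iso_def quo_def by blast
  have hom: "\<phi> \<in> ring_hom (HAlg f1) (HAlg f2)" and bij: "bij_betw \<phi> (range (quo f1)) (range (quo f2))"
    using iso by (auto simp: ring_iso_def carrier_HAlg)
  have "\<exists>v. \<phi> (quo f1 u) = quo f2 v" for u
    using bij unfolding bij_betw_def by (metis imageE imageI rangeI)
  \<comment> \<open>The representatives \<open>s u\<close> are arbitrary; \<open>T\<close> is still
    additive and multiplicative because \<open>rep f2\<close> is constant on cosets.\<close>
  then obtain s where s: "\<And>u. \<phi> (quo f1 u) = quo f2 (s u)" by metis
  define T where "T = (\<lambda>u. rep f2 (s u))"
  have T: "T u = rep f2 v \<longleftrightarrow> \<phi> (quo f1 u) = quo f2 v" for u v
    by (simp add: T_def s quo_eq_iff_rep)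
  have "T (u + v) = rep f2 (s u + s v)" for u v
    using ring_hom_add[OF hom, of "quo f1 u" "quo f1 v"]
    by (simp only: T HAlg_simps s carrier_HAlg rangeI)
  moreover have "T (u * v) = rep f2 (s u * s v)" for u v
    using ring_hom_mult[OF hom, of "quo f1 u" "quo f1 v"]
    by (simp only: T HAlg_simps s carrier_HAlg rangeI)
  moreover have "T (scal c) = osc c" for c
    using T[of "scal c" "scal c"] sc by simp
  ultimately have 1: "alg_hom osc T"
    by (simp add: alg_hom_def) (simp add: T_def)
  have "T u = 0 \<longleftrightarrow> rep f1 u = 0" for u
  proof -
    have "T u = 0 \<longleftrightarrow> \<phi> (quo f1 u) = \<phi> (quo f1 0)"
      using T[of u 0] T[of 0 0] alg_hom_zero[OF 1] by simp
    also have "\<dots> \<longleftrightarrow> quo f1 u = quo f1 0"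
      using bij by (auto simp: bij_betw_def inj_on_def)
    finally show ?thesis by (simp add: quo_eq_iff_rep)
  qed
  moreover have "range T = range (rep f2)"
  proof -
    have "rep f2 v \<in> range T" for v
    proof -
      have "quo f2 v \<in> \<phi> ` range (quo f1)"
        using bij by (simp add: bij_betw_def)
      then obtain u where "\<phi> (quo f1 u) = quo f2 v" by force
      then show ?thesis using T[of u v] by (metis rangeI)
    qed
    then show ?thesis by (auto simp: T_def)
  qed
  ultimately show thesis by (rule that[OF 1])
qed

section \<open>Construction of isomorphisms by substitution of generators\<close>

definition preserves_rels :: "complex poly \<Rightarrow> complex poly \<Rightarrow> (freealg \<Rightarrow> freealg) \<Rightarrow> bool" where
  "preserves_rels f1 f2 S \<longleftrightarrow> alg_hom scal S \<and> (\<forall>r\<in>rels f1. S r \<in> relideal f2)"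

lemma preserves_rels_cg:
  assumes "preserves_rels f1 f2 S" "cg f1 u v" shows "cg f2 (S u) (S v)"
proof -
  have S: "alg_hom scal S" using assms by (simp add: preserves_rels_def)
  have "two_sided {u. S u \<in> relideal f2}"
    using two_sided_relideal[of f2]
    by (simp add: two_sided_def alg_hom_zero[OF S] alg_homD[OF S])
  then have "relideal f1 \<subseteq> {u. S u \<in> relideal f2}"
    using assms(1) by (intro relideal_minimal) (auto simp: preserves_rels_def)
  then show ?thesis
    using assms(2) by (auto simp: cg_def alg_hom_diff[OF S, symmetric])
qed

lemma cg_id_of_gens:
  assumes "alg_hom scal S" "cg f (S xv) xv" "cg f (S yv) yv" "cg f (S hv) hv"
  shows "cg f (S u) u"
  by (induction u rule: freealg_induct)
    (simp_all add: assms alg_homD[OF assms(1)] cg_refl cg_add cg_mult)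

lemma alg_hom_comp: "alg_hom scal S \<Longrightarrow> alg_hom \<sigma> R \<Longrightarrow> alg_hom \<sigma> (\<lambda>u. R (S u))"
  by (simp add: alg_hom_def)

text \<open>Both substitutions descend to the quotients, and the composites fix the generators
  there, so the induced maps are mutually inverse.\<close>

lemma alg_isoI:
  assumes S: "preserves_rels f1 f2 S" and R: "preserves_rels f2 f1 R"
    and RS: "cg f1 (R (S xv)) xv" "cg f1 (R (S yv)) yv" "cg f1 (R (S hv)) hv"
    and SR: "cg f2 (S (R xv)) xv" "cg f2 (S (R yv)) yv" "cg f2 (S (R hv)) hv"
  shows "alg_iso f1 f2"
proof -
  have S': "alg_hom scal S" and R': "alg_hom scal R"
    using S R by (auto simp: preserves_rels_def)
  have RS: "cg f1 (R (S u)) u" for u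
    by (rule cg_id_of_gens[OF alg_hom_comp[OF S' R'] RS])
  have SR: "cg f2 (S (R u)) u" for u
    by (rule cg_id_of_gens[OF alg_hom_comp[OF R' S'] SR])
  define \<phi> where "\<phi> = (\<lambda>A. quo f2 (S (SOME u. quo f1 u = A)))"
  have \<phi>: "\<phi> (quo f1 u) = quo f2 (S u)" for u
    unfolding \<phi>_def quo_eq_iff
    by (rule preserves_rels_cg[OF S]) (metis (mono_tags, lifting) cg_refl someI_ex)
  have "\<phi> \<in> ring_iso (HAlg f1) (HAlg f2)"
  proof (rule ring_iso_memI)
    have "inj_on \<phi> (range (quo f1))"
    proof (rule inj_onI, clarify)
      fix u v assume "\<phi> (quo f1 u) = \<phi> (quo f1 v)"
      then have "cg f1 (R (S u)) (R (S v))"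
        by (intro preserves_rels_cg[OF R]) (simp add: \<phi> quo_eq_iff)
      then show "quo f1 u = quo f1 v"
        unfolding quo_eq_iff using RS cg_sym cg_trans by blast
    qed
    moreover have "\<phi> ` range (quo f1) = range (quo f2)"
    proof -
      have "quo f2 v \<in> \<phi> ` range (quo f1)" for v
        by (rule image_eqI[of _ _ "quo f1 (R v)"]) (unfold \<phi> quo_eq_iff, rule cg_sym[OF SR], rule rangeI)
      then show ?thesis by (auto simp: \<phi>)
    qed
    ultimately show "bij_betw \<phi> (carrier (HAlg f1)) (carrier (HAlg f2))"
      by (simp add: bij_betw_def carrier_HAlg)
  qed (auto simp: carrier_HAlg HAlg_simps \<phi> alg_homD[OF S'] alg_hom_scal[OF S', of 1, unfolded scal_1])
  moreover have "\<phi> (quo f1 (scal c)) = quo f2 (scal c)" for c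
    by (simp add: \<phi> alg_hom_scal[OF S'])
  ultimately show ?thesis unfolding alg_iso_def quo_def by blast
qed

text \<open>Since \<open>h\<close> becomes \<open>s h + b\<close>, the difference
  \<open>f(h) - h\<close> gets scaled by \<open>s\<close>; scaling \<open>y\<close> does the same to
  \<open>y x - x y\<close>.\<close>

definition affine_subst :: "complex \<Rightarrow> complex \<Rightarrow> freealg \<Rightarrow> freealg" where
  "affine_subst b s = F.eval (\<lambda>g. case g of Xg \<Rightarrow> xv | Yg \<Rightarrow> scal s * yv | Hg \<Rightarrow> F.pev [:b, s:] hv)"

lemma affine_subst_hom: "alg_hom scal (affine_subst b s)"
  by (simp add: affine_subst_def F.alg_hom_eval)

lemma affine_subst_gens: "affine_subst b s xv = xv" "affine_subst b s yv = scal s * yv" "affine_subst b s hv = F.pev [:b, s:] hv"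
  by (simp_all add: affine_subst_def F.eval_gens)

lemma affine_subst_pev: "affine_subst b s (F.pev p hv) = F.pev (pcompose p [:b, s:]) hv"
  using F.alg_hom_f_at_h[OF affine_subst_hom[of b s], of p]
  by (simp only: affine_subst_gens f_at_h_eq F.pev_pcompose)

lemma preserves_rels_affS:
  assumes "pcompose [:b, s:] f2 = pcompose f1 [:b, s:]"
  shows "preserves_rels f1 f2 (affine_subst b s)"
proof -
  let ?L = "[:b, s:]"
  note ts = two_sided_relideal[of f2]
  note simps = alg_homD[OF affine_subst_hom] alg_hom_diff[OF affine_subst_hom] affine_subst_gens affine_subst_pev f_at_h_eq
  have "affine_subst b s (hv * xv - xv * f_at_h f1) = F.pev ?L hv * xv - xv * F.pev (pcompose ?L f2) hv"
    unfolding simps assms ..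
  moreover have "\<dots> \<in> relideal f2"
    using relideal_rels(1)[of f2] unfolding f_at_h_eq by (rule F.pev_intertwine_mod[OF ts])
  moreover have "affine_subst b s (yv * hv - f_at_h f1 * yv) =
      scal s * (yv * F.pev ?L hv - F.pev (pcompose ?L f2) hv * yv)"
    unfolding simps assms right_diff_distrib mult.assoc F.\<sigma>_left_comm ..
  moreover have "\<dots> \<in> relideal f2"
    using F.pev_intertwine_mod'[OF ts relideal_rels(2)[of f2, unfolded f_at_h_eq], of ?L] ts
    unfolding two_sided_def by blast
  moreover have "affine_subst b s ((yv * xv - xv * yv) - (f_at_h f1 - hv)) =
      scal s * ((yv * xv - xv * yv) - (f_at_h f2 - hv))"
  proof -
    have "F.pev (pcompose ?L f2) hv - F.pev ?L hv = scal s * (F.pev f2 hv - hv)"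
      by (simp add: F.pev_pcompose right_diff_distrib F.\<sigma>_0 scal_comm[of s])
    then show ?thesis
      unfolding simps assms[symmetric] by (simp add: right_diff_distrib mult.assoc F.\<sigma>_left_comm)
  qed
  moreover have "\<dots> \<in> relideal f2"
    using relideal_rels(3)[of f2] ts unfolding two_sided_def by blast
  ultimately show ?thesis
    by (simp add: preserves_rels_def affine_subst_hom rels_def)
qed

lemma scal_scal_mult: "a * b = 1 \<Longrightarrow> scal a * (scal b * u) = u"
  by (simp add: mult.assoc[symmetric] scal_mult[symmetric] scal_1)

text \<open>The formula for \<open>f2\<close> is conjugation of \<open>f1\<close> by the affine map
  \<open>M = a h + c\<close> with inverse \<open>L\<close>, so \<open>L\<close> and \<open>M\<close>
  intertwine the two polynomials. No degree is assumed: constants and linear polynomials are handled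
  by it too.\<close>

lemma alg_iso_conj:
  assumes a: "a \<noteq> 0" and f2: "f2 = smult a (pcompose f1 [:- c / a, 1 / a:]) + [:c:]"
  shows "alg_iso f1 f2"
proof -
  let ?L = "[:- c / a, 1 / a:]" and ?M = "[:c, a:]"
  have c1: "pcompose ?M ?L = [:0, 1:]" and c2: "pcompose ?L ?M = [:0, 1:]"
    using a by (simp_all add: pcompose_pCons)
  have f2': "f2 = pcompose ?M (pcompose f1 ?L)"
    by (simp add: f2 pcompose_pCons)
  have 1: "preserves_rels f1 f2 (affine_subst (- c / a) (1 / a))"
    by (rule preserves_rels_affS) (simp only: f2' pcompose_assoc c2 pcompose_X)
  have 2: "preserves_rels f2 f1 (affine_subst c a)"
    by (rule preserves_rels_affS) (simp only: f2' pcompose_assoc[symmetric] c2 pcompose_X_right)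
  have "affine_subst c a (affine_subst (- c / a) (1 / a) yv) = yv" "affine_subst (- c / a) (1 / a) (affine_subst c a yv) = yv"
    unfolding affine_subst_gens alg_homD[OF affine_subst_hom] using a by (simp_all add: scal_scal_mult)
  moreover have "affine_subst c a (affine_subst (- c / a) (1 / a) hv) = hv" "affine_subst (- c / a) (1 / a) (affine_subst c a hv) = hv"
    unfolding affine_subst_gens affine_subst_pev c1 c2 F.pev_X by (rule refl)+
  ultimately show ?thesis
    by (intro alg_isoI[OF 1 2]) (simp_all only: affine_subst_gens(1) cg_refl)
qed

definition swap_subst :: "complex poly \<Rightarrow> freealg \<Rightarrow> freealg" where
  "swap_subst p = F.eval (\<lambda>g. case g of Xg \<Rightarrow> yv | Yg \<Rightarrow> xv | Hg \<Rightarrow> F.pev p hv)"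

lemma swap_subst_hom: "alg_hom scal (swap_subst p)"
  by (simp add: swap_subst_def F.alg_hom_eval)

lemma swap_subst_gens: "swap_subst p xv = yv" "swap_subst p yv = xv" "swap_subst p hv = F.pev p hv"
  by (simp_all add: swap_subst_def F.eval_gens)

lemma swap_subst_pev: "swap_subst p (F.pev q hv) = F.pev (pcompose q p) hv"
  using F.alg_hom_f_at_h[OF swap_subst_hom[of p], of q]
  by (simp only: swap_subst_gens f_at_h_eq F.pev_pcompose)

text \<open>Exchanging \<open>x\<close> and \<open>y\<close> and sending \<open>h\<close> to
  \<open>f2(h)\<close> interchanges the first two relations and preserves the third, each up to
  sign.\<close>

lemma preserves_rels_swapS:
  assumes "pcompose f1 f2 = [:0, 1:]"
  shows "preserves_rels f1 f2 (swap_subst f2)"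
proof -
  note simps = alg_homD[OF swap_subst_hom] alg_hom_diff[OF swap_subst_hom] swap_subst_gens swap_subst_pev f_at_h_eq assms F.pev_X
  have eqs: "swap_subst f2 (hv * xv - xv * f_at_h f1) = - (yv * hv - f_at_h f2 * yv)"
    "swap_subst f2 (yv * hv - f_at_h f1 * yv) = - (hv * xv - xv * f_at_h f2)"
    "swap_subst f2 ((yv * xv - xv * yv) - (f_at_h f1 - hv)) = - ((yv * xv - xv * yv) - (f_at_h f2 - hv))"
    unfolding simps by simp_all
  have "\<forall>r\<in>rels f1. swap_subst f2 r \<in> relideal f2"
    unfolding rels_def ball_simps eqs
    by (intro conjI TrueI two_sided_uminus[OF two_sided_relideal] relideal_rels)
  with swap_subst_hom show ?thesis
    unfolding preserves_rels_def by blast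
qed

lemma alg_iso_inverse:
  assumes "pcompose f1 f2 = [:0, 1:]" "pcompose f2 f1 = [:0, 1:]"
  shows "alg_iso f1 f2"
proof -
  have 1: "preserves_rels f1 f2 (swap_subst f2)" "preserves_rels f2 f1 (swap_subst f1)"
    using assms by (simp_all only: preserves_rels_swapS)
  have "swap_subst f1 (swap_subst f2 hv) = hv" "swap_subst f2 (swap_subst f1 hv) = hv"
    unfolding swap_subst_gens swap_subst_pev assms F.pev_X by (rule refl)+
  then show ?thesis
    by (intro alg_isoI[OF 1]) (simp_all only: swap_subst_gens(1,2) cg_refl)
qed

subsection \<open>Degree at least two\<close>

lemma alg_hom_pev: "alg_hom osc T \<Longrightarrow> T (F.pev p u) = O.pev p (T u)"
  by (induction p) (simp_all add: alg_hom_zero alg_homD)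

definition transports :: "complex poly \<Rightarrow> complex poly \<Rightarrow> (freealg \<Rightarrow> opr) \<Rightarrow> bool" where
  "transports f1 f2 T \<longleftrightarrow> alg_hom osc T \<and> (\<forall>u. T u = 0 \<longleftrightarrow> rep f1 u = 0) \<and> range T = range (rep f2)"

lemma alg_iso_transports: assumes "alg_iso f1 f2" obtains T where "transports f1 f2 T"
  using alg_iso_imp_hom[OF assms] unfolding transports_def by metis

lemma transports_hom: "transports f1 f2 T \<Longrightarrow> alg_hom osc T"
  by (simp add: transports_def)

lemma transports_eq_iff: "transports f1 f2 T \<Longrightarrow> T u = T v \<longleftrightarrow> rep f1 u = rep f1 v"
  unfolding transports_def using alg_hom_diff[of osc T u v] rep_simps(2)[of f1 u v]
  by (metis eq_iff_diff_eq_0)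

lemma transports_in_range: "transports f1 f2 T \<Longrightarrow> T u \<in> range (rep f2)"
  by (metis rangeI transports_def)

lemma transports_ex: assumes "transports f1 f2 T" obtains u where "T u = rep f2 v"
proof -
  have "rep f2 v \<in> range T" using assms by (simp add: transports_def)
  then show thesis using that by force
qed

lemma transports_rels:
  assumes "transports f1 f2 T"
  shows "T hv * T xv = T xv * O.pev f1 (T hv)"
    and "T yv * T hv = O.pev f1 (T hv) * T yv"
    and "T yv * T xv - T xv * T yv = O.pev f1 (T hv) - T hv"
proof -
  note T = transports_hom[OF assms]
  have "T (hv * xv) = T (xv * F.pev f1 hv)" "T (yv * hv) = T (F.pev f1 hv * yv)"
    "T (yv * xv - xv * yv) = T (F.pev f1 hv - hv)"
    unfolding transports_eq_iff[OF assms] by (simp_all add: opH_opX opY_opH opY_opX)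
  then show "T hv * T xv = T xv * O.pev f1 (T hv)"
    "T yv * T hv = O.pev f1 (T hv) * T yv"
    "T yv * T xv - T xv * T yv = O.pev f1 (T hv) - T hv"
    by (simp_all add: alg_homD[OF T] alg_hom_diff[OF T] alg_hom_pev[OF T])
qed

lemma co_opX: "co opX = delta 1 1 0"
  using co_omon[of f 1 1 0] by (simp add: omon_def O.pev_1)

lemma opX_neq_0: "opX \<noteq> 0"
proof
  assume "opX = 0"
  then have "co opX 1 0 = co 0 1 0" by simp
  then show False by (simp add: co_opX delta_def)
qed

lemma co_osc: "co (osc c) = delta 0 [:c:] 0"
  by (intro ext) (simp add: co_def delta_def)

lemma co_opH: "co (opH f) = delta 0 [:0, 1:] 0"
  using co_pev_opH[of "[:0, 1:]" f] by (simp only: O.pev_X)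

lemma pev_opH_inject: "O.pev p (opH f) = O.pev q (opH f) \<Longrightarrow> p = q"
proof -
  assume "O.pev p (opH f) = O.pev q (opH f)"
  then have "co (O.pev p (opH f)) 0 0 = co (O.pev q (opH f)) 0 0" by simp
  then show "p = q" by (simp add: co_pev_opH delta_def)
qed

lemma lead_add_delta:
  assumes "lead w m n" "m \<noteq> 0 \<or> n \<noteq> 0"
  shows "lead (delta 0 q 0 + w) m n"
  using assms by (auto simp: lead_def below_def delta_def)

text \<open>A constant lies strictly below any term with pair other than \<open>(0,0)\<close>, so in
  Horner's scheme only the products contribute to the leading pair.\<close>

lemma lead_pev:
  assumes f: "degree f \<ge> 1" and A: "A \<in> range (rep f)" and lead: "lead (co A) I K"
    and IK: "I \<noteq> 0 \<or> K \<noteq> 0" and "p \<noteq> 0"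
  shows "lead (co (O.pev p A)) (degree p * I) (degree p * K)"
  using \<open>p \<noteq> 0\<close>
proof (induction p)
  case (pCons c p)
  show ?case
  proof (cases "p = 0")
    case True
    then show ?thesis using pCons by (simp add: co_osc lead_delta)
  next
    case False
    have "lead (co (A * O.pev p A)) (I + degree p * I) (K + degree p * K)"
      by (rule lead_mult(1)[OF f A lead pCons.IH[OF False]])
    then have "lead (delta 0 [:c:] 0 + co (A * O.pev p A)) (I + degree p * I) (K + degree p * K)"
      by (rule lead_add_delta) (use IK in auto)
    moreover have "co (O.pev (pCons c p) A) = delta 0 [:c:] 0 + co (A * O.pev p A)"
      by (simp only: O.pev_pCons co_simps co_osc)
    ultimately show ?thesis
      by (simp only: degree_pCons_eq[OF False] mult_Suc)
  qed
qed simp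

text \<open>Comparing leading terms, an element that satisfies a twisted commutation relation of degree
  at least two has leading bidegree \<open>(0,0)\<close>.\<close>
lemma twisted_commute_imp_pev:
  assumes f: "degree f \<ge> 1" and A: "A \<in> range (rep f)" and B: "B \<in> range (rep f)" "B \<noteq> 0"
    and AB: "A * B = B * O.pev g A" and g: "degree g \<ge> 2"
  shows "\<exists>p. A = O.pev p (opH f)"
proof (cases "A = 0")
  case True
  then show ?thesis by (intro exI[of _ 0]) simp
next
  case False
  obtain I K where IK: "lead (co A) I K" using ex_lead_rep[OF A False] by blast
  obtain I' K' where IK': "lead (co B) I' K'" using ex_lead_rep[OF B] by blast
  have "I = 0 \<and> K = 0"
  proof (rule ccontr)
    assume *: "\<not> ?thesis"
    have "g \<noteq> 0" using g by auto
    with * have "lead (co (O.pev g A)) (degree g * I) (degree g * K)"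
      by (intro lead_pev[OF f A IK]) auto
    then have "lead (co (A * B)) (I' + degree g * I) (K' + degree g * K)"
      unfolding AB by (rule lead_mult(1)[OF f B(1) IK'])
    with lead_mult(1)[OF f A IK IK'] have "I + I' = I' + degree g * I \<and> K + K' = K' + degree g * K"
      by (rule lead_unique)
    then have "I = degree g * I" "K = degree g * K" by simp_all
    then have "I = 0" "K = 0" using g by auto
    with * show False by simp
  qed
  then show ?thesis using rep_eq_pev[OF A] IK by auto
qed

text \<open>Compare both sides at the leading pair of \<open>B\<close> and cancel the leading
  coefficient of \<open>B\<close>.\<close>

lemma pev_commute_imp_iter:
  assumes B: "B \<in> range (rep f)" "B \<noteq> 0" and eq: "O.pev p (opH f) * B = B * O.pev r (opH f)"
  obtains I K where "pcompose p (iter f I) = pcompose r (iter f K)"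
proof -
  obtain I K where IK: "lead (co B) I K" using ex_lead_rep[OF B] by blast
  \<comment> \<open>Stated with \<open>below\<close> rather than \<open>lead\<close> because
    \<open>p\<close> or \<open>r\<close> may be zero.\<close>
  have d: "below (delta 0 q 0) 0 0" for q by (auto simp: below_def delta_def)
  have B': "below (co B) I K" using IK by (simp add: lead_def)
  have "app (O.pev p (opH f)) (co B) (0 + I) (0 + K) =
      pcompose (delta 0 p 0 0 0) (iter f I) * pcompose (co B I K) (iter f 0)"
    using below_rep_app(2)[OF range_rep_pev _ B', of p f 0 0] d by (simp add: co_pev_opH)
  moreover have "app B (delta 0 r 0) (I + 0) (K + 0) =
      pcompose (co B I K) (iter f 0) * pcompose (delta 0 r 0 0 0) (iter f K)"
    by (rule below_rep_app(2)[OF B(1) B' d])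
  moreover have "app (O.pev p (opH f)) (co B) = app B (delta 0 r 0)"
    using arg_cong[OF eq, of co] by (simp add: co_mult co_pev_opH)
  ultimately have "pcompose p (iter f I) = pcompose r (iter f K)"
    using IK by (simp add: delta_def lead_def)
  then show thesis by (rule that)
qed

lemma transports_degree_ge_2:
  assumes T: "transports f1 f2 T" and "degree f1 \<ge> 2" "degree f2 \<ge> 1"
  obtains p I K where "T hv = O.pev p (opH f2)" "degree p \<ge> 1"
    "pcompose p (iter f2 I) = pcompose (pcompose f1 p) (iter f2 K)"
    "degree f2 ^ I = degree f1 * degree f2 ^ K"
proof -
  note hom = transports_hom[OF T]
  have X: "T xv \<noteq> 0" using T opX_neq_0 by (simp add: transports_def)
  obtain p where p: "T hv = O.pev p (opH f2)"
    using twisted_commute_imp_pev[OF assms(3) transports_in_range[OF T] transports_in_range[OF T] X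
        transports_rels(1)[OF T] assms(2)] by blast
  \<comment> \<open>A constant \<open>p\<close> would make \<open>h\<close> a scalar already in the
    first algebra, contrary to the normal form.\<close>
  have "degree p \<noteq> 0"
  proof
    assume "degree p = 0"
    then obtain c where "p = [:c:]" by (rule degree_eq_zeroE)
    then have "T (hv) = T (scal c)" using p by (simp add: alg_homD[OF hom])
    then have "opH f1 = osc c" unfolding transports_eq_iff[OF T] by simp
    then have "co (opH f1) 0 0 = co (osc c) 0 0" by simp
    then show False by (simp add: co_osc co_opH delta_def)
  qed
  then have dp: "degree p \<ge> 1" by simp
  have "O.pev p (opH f2) * T xv = T xv * O.pev (pcompose f1 p) (opH f2)"
    using transports_rels(1)[OF T] unfolding p O.pev_pcompose .
  then obtain I K where IK: "pcompose p (iter f2 I) = pcompose (pcompose f1 p) (iter f2 K)"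
    by (rule pev_commute_imp_iter[OF transports_in_range[OF T] X])
  from arg_cong[OF IK, of degree]
  have "degree p * degree f2 ^ I = degree p * (degree f1 * degree f2 ^ K)"
    unfolding degree_pcompose degree_iter by (simp only: mult.assoc mult.left_commute)
  then have "degree f2 ^ I = degree f1 * degree f2 ^ K" using dp by simp
  then show thesis using that[OF p dp IK] by blast
qed

lemma power_eq_mult_powerD:
  assumes "d ^ I = m * d ^ K" "m \<ge> (2::nat)" "d \<ge> 1"
  shows "d \<ge> 2" "d \<le> m"
proof -
  show d: "d \<ge> 2"
  proof (rule ccontr)
    assume "\<not> ?thesis"
    then have "d = 1" using assms(3) by simp
    then show False using assms by simp
  qed
  have "d ^ K < d ^ I" using assms d by simp
  then have "K < I" using d by simp
  then obtain j where "I = Suc (K + j)" by (metis less_iff_Suc_add)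
  then have "m = d * d ^ j" using assms d by (simp add: power_add)
  then show "d \<le> m" using d by simp
qed

text \<open>The bound \<open>le\<close> also yields degree at least two for the second polynomial,
  so it applies to the inverse isomorphism and gives equality.\<close>

lemma alg_iso_degree_ge_2:
  assumes "alg_iso f1 f2" "degree f1 \<ge> 2" "degree f2 \<ge> 1"
  shows "degree f2 = degree f1"
proof -
  have le: "degree g2 \<ge> 2 \<and> degree g2 \<le> degree g1"
    if iso: "alg_iso g1 g2" and d: "degree g1 \<ge> 2" "degree g2 \<ge> 1" for g1 g2
  proof -
    obtain T where T: "transports g1 g2 T" by (rule alg_iso_transports[OF iso])
    obtain I K where "degree g2 ^ I = degree g1 * degree g2 ^ K"
      by (rule transports_degree_ge_2[OF T d])
    from power_eq_mult_powerD[OF this d] show ?thesis by blast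
  qed
  show ?thesis
    using le[OF assms] le[OF alg_iso_sym[OF assms(1)]] assms(2) by force
qed

lemma alg_iso_imp_conj:
  assumes iso: "alg_iso f1 f2" and d1: "degree f1 \<ge> 2" and d2: "degree f2 \<ge> 1"
  obtains a c where "a \<noteq> 0" "f2 = smult a (pcompose f1 [:- c / a, 1 / a:]) + [:c:]"
proof -
  obtain T where T: "transports f1 f2 T" by (rule alg_iso_transports[OF iso])
  note hom = transports_hom[OF T]
  have d: "degree f2 = degree f1" by (rule alg_iso_degree_ge_2[OF assms])
  obtain p I K where p: "T hv = O.pev p (opH f2)" "degree p \<ge> 1"
    and IK: "pcompose p (iter f2 I) = pcompose (pcompose f1 p) (iter f2 K)"
      "degree f2 ^ I = degree f1 * degree f2 ^ K"
    by (rule transports_degree_ge_2[OF T d1 d2])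
  have "degree f2 ^ I = degree f2 ^ Suc K" using IK(2) d by simp
  then have I: "I = Suc K" using d d1 by (subst (asm) power_inject_exp) auto
  \<comment> \<open>Composition on the right with a nonconstant iterate is injective.\<close>
  have "pcompose (pcompose p f2 - pcompose f1 p) (iter f2 K) = 0"
    using IK(1) unfolding I pcompose_iter[symmetric] by (simp add: pcompose_diff pcompose_assoc)
  then have comm: "pcompose p f2 = pcompose f1 p"
    using d2 by (simp add: pcompose_iter_eq_0)
  \<comment> \<open>The preimages of \<open>h\<close> and \<open>x\<close> satisfy the relation of
    \<open>f2\<close> in the first algebra. Hence the inverse isomorphism also sends
    \<open>h\<close> to some \<open>q(h)\<close>, and \<open>q\<close> composed with
    \<open>p\<close> is the identity.\<close>
  obtain u where u: "T u = rep f2 hv" by (rule transports_ex[OF T])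
  obtain v where v: "T v = rep f2 xv" by (rule transports_ex[OF T])
  have "T (u * v) = T (v * F.pev f2 u)"
    using opH_opX[of f2] by (simp add: alg_homD[OF hom] alg_hom_pev[OF hom] u v)
  then have "rep f1 u * rep f1 v = rep f1 v * O.pev f2 (rep f1 u)"
    unfolding transports_eq_iff[OF T] by (simp add: alg_hom_pev[OF alg_hom_rep])
  moreover have "rep f1 v \<noteq> 0"
    using T v opX_neq_0 unfolding transports_def by (metis rep_gens(1))
  ultimately obtain q where "rep f1 u = O.pev q (opH f1)"
    using twisted_commute_imp_pev[of f1 "rep f1 u" "rep f1 v" f2] d d1 by auto
  then have "rep f1 u = rep f1 (F.pev q hv)" by simp
  then have "T u = O.pev q (T hv)"
    unfolding transports_eq_iff[OF T, symmetric] alg_hom_pev[OF hom] .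
  then have "O.pev (pcompose q p) (opH f2) = O.pev [:0, 1:] (opH f2)"
    unfolding u p(1) O.pev_pcompose O.pev_X by simp
  then have "pcompose q p = [:0, 1:]" by (rule pev_opH_inject)
  then have "degree q * degree p = 1"
    by (metis degree_pcompose degree_pCons_eq_if degree_1 one_neq_zero one_pCons One_nat_def)
  then have "degree p = 1" by simp
  then obtain b s where ps: "p = [:b, s:]" "s \<noteq> 0"
    by (metis degree1_coeffs)
  have sf2: "smult s f2 + [:b:] = pcompose f1 [:b, s:]"
    using comm by (simp add: ps pcompose_pCons add.commute)
  then have "f2 = smult (1 / s) (pcompose f1 [:b, s:]) + [:- b / s:]"
    using ps(2) by (simp add: field_simps smult_add_right flip: sf2)
  \<comment> \<open>The conjugating map is the inverse of \<open>p = s h + b\<close>, which has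
    slope \<open>1/s\<close> and constant term \<open>-b/s\<close>.\<close>
  then show thesis using that[of "1 / s" "- b / s"] ps(2) by simp
qed

subsection \<open>Constant and linear polynomials\<close>

lemma alg_iso_degree_0:
  assumes iso: "alg_iso f1 f2" and "degree f2 = 0"
  shows "degree f1 = 0"
proof (rule ccontr)
  assume d1: "degree f1 \<noteq> 0"
  obtain c where f2: "f2 = [:c:]" using assms(2) by (rule degree_eq_zeroE)
  obtain T where T: "transports f1 f2 T" by (rule alg_iso_transports[OF iso])
  note hom = transports_hom[OF T]
  obtain u where u: "T u = rep f2 (hv - scal c)" by (rule transports_ex[OF T])
  obtain v where v: "T v = rep f2 xv" by (rule transports_ex[OF T])
  have "T (u * v) = 0"
    using opH_opX[of f2] O.\<sigma>_comm[of c opX] by (simp add: alg_homD[OF hom] u v f2 left_diff_distrib)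
  then have "rep f1 u * rep f1 v = 0" using T by (simp add: transports_def)
  then have "rep f1 u = 0 \<or> rep f1 v = 0"
    using d1 by (intro rep_no_zero_divisors[of f1]) auto
  then have "T u = 0 \<or> T v = 0" using T by (simp add: transports_def)
  moreover have "T u \<noteq> 0"
  proof
    assume "T u = 0"
    then have "co (rep f2 (hv - scal c)) 0 0 = co 0 0 0" unfolding u by simp
    then show False by (simp add: co_osc co_opH delta_def)
  qed
  ultimately show False using v opX_neq_0 by simp
qed

section \<open>Specialisation at a fixed point\<close>

interpretation C: scalars "\<lambda>c. [:[:c:]:] :: complex poly poly"
  by unfold_locales (simp_all add: one_pCons mult.commute)

text \<open>At a fixed point \<open>\<lambda>\<close> of \<open>f\<close> the specialisation \<open>h = \<lambda>\<close> maps the algebra onto \<open>C[x,y]\<close>;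
  the outer variable of the codomain is \<open>x\<close>, the inner one \<open>y\<close>.\<close>
definition chi :: "complex \<Rightarrow> freealg \<Rightarrow> complex poly poly" where
  "chi l = C.eval (\<lambda>g. case g of Xg \<Rightarrow> [:0, 1:] | Yg \<Rightarrow> [:[:0, 1:]:] | Hg \<Rightarrow> [:[:l:]:])"

lemma alg_hom_chi: "alg_hom (\<lambda>c. [:[:c:]:]) (chi l)"
  by (simp add: chi_def C.alg_hom_eval)

lemma chi_gens: "chi l xv = [:0, 1:]" "chi l yv = [:[:0, 1:]:]" "chi l hv = [:[:l:]:]"
  by (simp_all add: chi_def C.eval_gens)

lemma poly_iter_fixed: "poly f l = l \<Longrightarrow> poly (iter f n) l = l"
  by (induction n) (simp_all add: poly_pcompose)

text \<open>At a fixed point every iterate takes the value \<open>l\<close>: composition with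
  \<open>f\<close> leaves values at \<open>l\<close> unchanged and the correction term of
  \<open>opY\<close> vanishes. What remains is multiplication in \<open>C[x,y]\<close>.\<close>

lemma chi_app:
  assumes l: "poly f l = l" and "\<And>i k. poly (w i k) l = coeff (coeff P i) k"
  shows "poly (app (rep f u) w i k) l = coeff (coeff (chi l u * P) i) k"
  using assms(2)
proof (induction u arbitrary: w P i k rule: freealg_induct)
  case (scal c)
  then show ?case by (simp add: alg_hom_scal[OF alg_hom_chi])
next
  case x
  then show ?case by (simp add: chi_gens app_opX coeff_pCons split: nat.splits)
next
  case y
  then show ?case
    by (simp add: chi_gens app_opY coeff_pCons poly_pcompose l poly_iter_fixed[OF l] del: iter.simps
        split: nat.splits)
next
  case h
  then show ?case by (simp add: chi_gens app_opH poly_iter_fixed[OF l])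
next
  case (add u v)
  then show ?case by (simp add: alg_hom_add[OF alg_hom_chi] distrib_right)
next
  case (mult u v)
  show ?case
    using mult(1)[of "app (rep f v) w" "chi l v * P"] mult(2)[of w P] mult(3)
    by (simp add: alg_hom_mult[OF alg_hom_chi] mult.assoc)
qed

lemma poly_co_rep:
  assumes l: "poly f l = l"
  shows "poly (co (rep f u) i k) l = coeff (coeff (chi l u) i) k"
  unfolding co_def using chi_app[OF l, of "delta 0 1 0" 1 u i k]
  by (simp add: delta_def)

lemma poly_co_commutator:
  assumes l: "poly f l = l" and "A \<in> range (rep f)" "B \<in> range (rep f)"
  shows "poly (co (A * B - B * A) i k) l = 0"
proof -
  obtain u v where uv: "A = rep f u" "B = rep f v" using assms by blast
  have "A * B - B * A = rep f (u * v - v * u)" by (simp add: uv)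
  then show ?thesis
    by (simp only: poly_co_rep[OF l] alg_hom_diff[OF alg_hom_chi] alg_hom_mult[OF alg_hom_chi])
      (simp add: mult.commute)
qed

text \<open>Leibniz rule for the coefficient of \<open>x\<close> in \<open>C[x,y]\<close>. It shows
  that if this coefficient vanishes on generators, it vanishes everywhere.\<close>

lemma poly_co_derivation:
  assumes l: "poly f l = l" and "A \<in> range (rep f)" "B \<in> range (rep f)"
  shows "poly (co (A * B) 1 0) l = poly (co A 1 0) l * poly (co B 0 0) l + poly (co A 0 0) l * poly (co B 1 0) l"
proof -
  obtain u v where uv: "A = rep f u" "B = rep f v" using assms by blast
  have "A * B = rep f (u * v)" by (simp add: uv)
  then show ?thesis
    by (simp only: uv poly_co_rep[OF l] alg_hom_mult[OF alg_hom_chi])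
      (simp add: coeff_mult algebra_simps)
qed

lemma alg_iso_identity:
  assumes iso: "alg_iso [:0, 1:] f2"
  shows "f2 = [:0, 1:]"
proof -
  obtain T where T: "transports [:0, 1:] f2 T" by (rule alg_iso_transports[OF iso])
  note hom = transports_hom[OF T]
  obtain u where u: "T u = rep f2 yv" by (rule transports_ex[OF T])
  obtain v where v: "T v = rep f2 xv" by (rule transports_ex[OF T])
  have "rep [:0, 1:] (u * v - v * u) = 0"
  proof (rule co_eq_0)
    \<comment> \<open>For \<open>f = h\<close> every complex number is a fixed point, so the
      coefficients of a commutator vanish identically.\<close>
    have "poly (co (rep [:0, 1:] (u * v - v * u)) i k) l = poly 0 l" for i k l
      using poly_co_commutator[of "[:0, 1:]" l "rep [:0, 1:] u" "rep [:0, 1:] v" i k] by simp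
    then have "co (rep [:0, 1:] (u * v - v * u)) i k = 0" for i k
      by (simp only: poly_eq_poly_eq_iff[symmetric] fun_eq_iff) simp
    then show "co (rep [:0, 1:] (u * v - v * u)) = 0" by (intro ext) simp
  qed (rule rangeI)
  then have "T (u * v - v * u) = 0" using T unfolding transports_def by blast
  then have "opY f2 * opX - opX * opY f2 = 0"
    by (simp add: alg_hom_diff[OF hom] alg_homD[OF hom] u v)
  then have "O.pev f2 (opH f2) = O.pev [:0, 1:] (opH f2)"
    by (simp only: opY_opX O.pev_X) simp
  then show ?thesis by (rule pev_opH_inject)
qed

text \<open>In the first algebra the nonzero scalar \<open>b\<close> is a commutator, but
  specialisation at \<open>l\<close> kills all commutators of the second.\<close>

lemma not_alg_iso_translation:
  assumes iso: "alg_iso [:b, 1:] f2" and "b \<noteq> 0" and l: "poly f2 l = l"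
  shows False
proof -
  obtain T where T: "transports [:b, 1:] f2 T" by (rule alg_iso_transports[OF iso])
  have "T yv * T xv - T xv * T yv = osc b"
    using transports_rels(3)[OF T] by (simp add: O.\<sigma>_1)
  then have "poly (co (osc b) 0 0) l = 0"
    using poly_co_commutator[OF l transports_in_range[OF T] transports_in_range[OF T]] by metis
  then show False using \<open>b \<noteq> 0\<close> by (simp add: co_osc delta_def)
qed

section \<open>Linear polynomials\<close>

lemma iter_linear: "iter [:0, a:] n = [:0, a ^ n:]"
  by (induction n) (simp_all add: pcompose_pCons)

text \<open>Right multiplication by \<open>p(h)\<close> acts on the coefficient of
  \<open>y^k\<close> through the \<open>k\<close>-th iterate, and it commutes with left
  multiplication.\<close>

lemma app_rep_mult_right:
  "app (rep f u) (\<lambda>i k. w i k * pcompose p (iter f k)) =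
    (\<lambda>i k. app (rep f u) w i k * pcompose p (iter f k))"
proof (induction u arbitrary: w rule: freealg_induct)
  case (scal c)
  show ?case by (simp add: psc_def)
next
  case x
  show ?case by (intro ext) (simp add: app_opX split: nat.splits)
next
  case y
  show ?case
    by (intro ext) (simp add: app_opY pcompose_mult pcompose_assoc algebra_simps split: nat.splits)
next
  case h
  show ?case by (intro ext) (simp add: app_opH)
next
  case (add u v)
  then show ?case by (intro ext) (simp add: distrib_right)
next
  case (mult u v)
  then show ?case by simp
qed

lemma co_mult_pev:
  assumes "A \<in> range (rep f)"
  shows "co (A * O.pev p (opH f)) i k = co A i k * pcompose p (iter f k)"
proof -
  obtain u where u: "A = rep f u" using assms by blast
  have "delta 0 p 0 = (\<lambda>i k. delta 0 1 0 i k * pcompose p (iter f k))"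
    by (intro ext) (simp add: delta_def)
  then show ?thesis
    unfolding co_mult co_pev_opH u by (simp only: app_rep_mult_right co_def)
qed

lemma co_opH_mult: "co (opH f * A) i k = iter f i * co A i k"
  by (simp add: co_mult app_opH)

lemma co_mult_opH: "A \<in> range (rep f) \<Longrightarrow> co (A * opH f) i k = co A i k * iter f k"
  using co_mult_pev[of A f "[:0, 1:]" i k] by (simp only: O.pev_X pcompose_X)

lemma opH_divides:
  assumes f: "f = [:0, a:]" "a \<noteq> 0" and A: "A \<in> range (rep f)" and 0: "\<And>i k. poly (co A i k) 0 = 0"
  obtains v where "A = opH f * rep f v"
proof -
  obtain u where u: "A = rep f u" using A by blast
  obtain N where N: "bounded (co A) N" unfolding u by (rule normal_form)
  \<comment> \<open>The factor \<open>1 / a^i\<close> compensates for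
    \<open>h x^i = a^i x^i h\<close>.\<close>
  define w where "w = (\<lambda>i k. smult (1 / a ^ i) (co A i k div [:0, 1:]))"
  have "bounded w N" using N by (auto simp: w_def bounded_def)
  then have co: "co (rep f (assemble N w)) = w" by (rule co_assemble)
  have "[:0, 1:] * (co A i k div [:0, 1:]) = co A i k" for i k
    using 0[of i k] by (intro dvd_mult_div_cancel) (simp add: poly_eq_0_iff_dvd)
  then have "[:0, a ^ i:] * w i k = co A i k" for i k
    using f(2) by (simp add: w_def)
  moreover have it: "iter f i = [:0, a ^ i:]" for i by (simp add: f(1) iter_linear)
  ultimately have "co (opH f * rep f (assemble N w)) = co A"
    by (intro ext) (simp only: co_opH_mult co it)
  moreover have "opH f * rep f (assemble N w) \<in> range (rep f)"
    by (metis rangeI rep_gens(3) rep_simps(3))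
  ultimately have "A = opH f * rep f (assemble N w)"
    by (intro co_inject[OF A]) (simp_all only:)
  then show thesis by (rule that)
qed

lemma osc_mult: "osc a * osc b = osc (a * b)"
  by (simp add: O.\<sigma>_mult)

lemma osc_cancel: assumes "c \<noteq> 0" "osc c * A = osc c * B" shows "A = B"
proof -
  have "osc (1 / c) * (osc c * A) = osc (1 / c) * (osc c * B)" by (simp only: assms(2))
  then show ?thesis using assms(1) by (simp add: mult.assoc[symmetric] osc_mult O.\<sigma>_1)
qed

lemma pev_linear: "O.pev [:0, a:] A = osc a * A"
  by (simp add: O.\<sigma>_0 O.\<sigma>_comm)

text \<open>Leading pairs add up to \<open>(0,0)\<close>, so both factors are polynomials in
  \<open>h\<close> with product 1.\<close>

lemma rep_unit:
  assumes f: "degree f \<ge> 1" and U: "U \<in> range (rep f)" and V: "V \<in> range (rep f)" and "U * V = 1"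
  obtains c where "c \<noteq> 0" "U = osc c"
proof -
  have "U \<noteq> 0" "V \<noteq> 0" using \<open>U * V = 1\<close> by auto
  obtain I K where IK: "lead (co U) I K" using ex_lead_rep[OF U \<open>U \<noteq> 0\<close>] by blast
  obtain I' K' where IK': "lead (co V) I' K'" using ex_lead_rep[OF V \<open>V \<noteq> 0\<close>] by blast
  have "lead (co (U * V)) 0 0"
    unfolding \<open>U * V = 1\<close> co_def by (simp add: lead_delta)
  with lead_mult(1)[OF f U IK IK'] have "I + I' = 0 \<and> K + K' = 0" by (rule lead_unique)
  with IK IK' have "lead (co U) 0 0" "lead (co V) 0 0" by auto
  then obtain p q where p: "U = O.pev p (opH f)" and q: "V = O.pev q (opH f)"
    using rep_eq_pev[OF U] rep_eq_pev[OF V] by blast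
  have "O.pev (p * q) (opH f) = O.pev 1 (opH f)"
    using \<open>U * V = 1\<close> by (simp add: p q O.pev_mult O.pev_1)
  then have "p * q = 1" by (rule pev_opH_inject)
  then have "p dvd 1" by (metis dvd_triv_left)
  then obtain c where "p = [:c:]" "c \<noteq> 0" by (auto simp: is_unit_poly_iff dvd_field_iff)
  then show thesis using that p by simp
qed

lemma commutator_opH:
  assumes T: "transports [:0, a:] g T"
  shows "osc (a - 1) * T hv = T yv * T xv - T xv * T yv"
proof -
  have "osc (a - 1) * T hv = osc a * T hv - T hv"
    using O.\<sigma>_add[of "a - 1" 1] by (simp add: O.\<sigma>_1 algebra_simps)
  then show ?thesis
    unfolding transports_rels(3)[OF T] pev_linear .
qed

lemma commutator_vanish:
  assumes "poly f l = l" "A \<in> range (rep f)" "B \<in> range (rep f)"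
    "osc s * D = A * B - B * A" "s \<noteq> 0"
  shows "poly (co D i k) l = 0"
proof -
  have "co (osc s * D) i k = smult s (co D i k)" by (simp add: co_mult)
  then show ?thesis
    using poly_co_commutator[OF assms(1-3), of i k] assms(4,5) by (metis mult_eq_0_iff poly_smult)
qed

lemma smult_eq_smult_imp_0: "smult a p = smult b p \<Longrightarrow> a \<noteq> b \<Longrightarrow> p = (0 :: 'a::idom poly)"
  by (metis right_minus_eq smult_diff_left smult_eq_0_iff)

lemma alg_iso_linear:
  assumes iso: "alg_iso [:0, a1:] [:0, a2:]" and a: "a1 \<noteq> 0" "a2 \<noteq> 0" "a1 \<noteq> 1" "a2 \<noteq> 1"
  shows "a1 = a2 \<or> a1 * a2 = 1"
proof (rule ccontr)
  assume neq: "\<not> ?thesis"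
  let ?f1 = "[:0, a1:]" and ?f2 = "[:0, a2:]"
  obtain T where T: "transports ?f1 ?f2 T" by (rule alg_iso_transports[OF iso])
  note hom = transports_hom[OF T] and ran = transports_in_range[OF T]
  have fix1: "poly ?f1 0 = 0" and fix2: "poly ?f2 0 = 0" by simp_all
  \<comment> \<open>Up to the nonzero factor \<open>a1 - 1\<close>, \<open>h\<close> is a
    commutator, hence so is its image; it vanishes at the fixed point 0 and is therefore divisible
    by \<open>h\<close>.\<close>
  have "poly (co (T hv) i k) 0 = 0" for i k
    using a by (intro commutator_vanish[OF fix2 ran ran commutator_opH[OF T]]) simp
  then obtain vU where U: "T hv = opH ?f2 * rep ?f2 vU"
    by (rule opH_divides[OF refl a(2) ran])
  obtain u0 where u0: "T u0 = rep ?f2 hv" by (rule transports_ex[OF T])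
  obtain u1 where u1: "T u1 = rep ?f2 yv" by (rule transports_ex[OF T])
  obtain u2 where u2: "T u2 = rep ?f2 xv" by (rule transports_ex[OF T])
  have "transports ?f2 ?f2 (rep ?f2)" by (simp add: transports_def alg_hom_rep)
  from commutator_opH[OF this] have "T (scal (a2 - 1) * u0) = T (u1 * u2 - u2 * u1)"
    by (simp add: alg_homD[OF hom] alg_hom_diff[OF hom] u0 u1 u2)
  then have comm: "osc (a2 - 1) * rep ?f1 u0 = rep ?f1 u1 * rep ?f1 u2 - rep ?f1 u2 * rep ?f1 u1"
    unfolding transports_eq_iff[OF T] by simp
  have "poly (co (rep ?f1 u0) i k) 0 = 0" for i k
    by (rule commutator_vanish[OF fix1 rangeI rangeI comm]) (use a in simp)
  then obtain v0 where "rep ?f1 u0 = opH ?f1 * rep ?f1 v0"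
    by (rule opH_divides[OF refl a(1) rangeI])
  then have "T u0 = T (hv * v0)"
    unfolding transports_eq_iff[OF T] by simp
  \<comment> \<open>The inverse isomorphism gives the opposite divisibility. Cancelling
    \<open>h\<close> in the domain makes the cofactor \<open>vU\<close> a unit, hence a
    scalar.\<close>
  then have "opH ?f2 * (1 - rep ?f2 vU * T v0) = 0"
    by (simp add: alg_homD[OF hom] u0 U right_diff_distrib mult.assoc)
  moreover have V: "T v0 \<in> range (rep ?f2)" by (rule ran)
  moreover have "(1 - rep ?f2 vU * T v0) \<in> range (rep ?f2)"
    using range_rep_diff[OF rangeI range_rep_mult[OF rangeI V], of "scal 1" vU] by (simp add: O.\<sigma>_1)
  moreover have "opH ?f2 \<in> range (rep ?f2)" by (metis rangeI rep_gens(3))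
  moreover have "opH ?f2 \<noteq> 0"
  proof
    assume "opH ?f2 = 0"
    then have "co (opH ?f2) 0 0 = co 0 0 0" by simp
    then show False by (simp add: co_opH delta_def)
  qed
  ultimately have "1 - rep ?f2 vU * T v0 = 0"
    using rep_no_zero_divisors[of ?f2 "opH ?f2" "1 - rep ?f2 vU * T v0"] a by auto
  then have "rep ?f2 vU * T v0 = 1" by simp
  then obtain c where c: "c \<noteq> 0" "rep ?f2 vU = osc c"
    using rep_unit[OF _ rangeI V, of vU] a by auto
  have H: "T hv = osc c * opH ?f2" using U c(2) by (simp add: O.\<sigma>_comm)
  have "osc c * (opH ?f2 * T xv) = osc c * (osc a1 * (T xv * opH ?f2))"
    using transports_rels(1)[OF T]
    unfolding pev_linear H mult.assoc O.\<sigma>_left_comm[of "T xv"] O.\<sigma>_left_comm[of "osc a1" c] .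
  then have X: "opH ?f2 * T xv = osc a1 * (T xv * opH ?f2)" by (rule osc_cancel[OF c(1)])
  have "osc c * (T yv * opH ?f2) = osc c * (osc a1 * (opH ?f2 * T yv))"
    using transports_rels(2)[OF T]
    unfolding pev_linear H mult.assoc O.\<sigma>_left_comm[of "T yv"] O.\<sigma>_left_comm[of "osc a1" c] .
  then have Y: "T yv * opH ?f2 = osc a1 * (opH ?f2 * T yv)" by (rule osc_cancel[OF c(1)])
  have co_sc: "co (osc s * D) i k = smult s (co D i k)" for s D i k by (simp add: co_mult)
  \<comment> \<open>In the coefficient of \<open>x\<close>, left multiplication by \<open>h\<close>
    contributes \<open>a2 h\<close> and right multiplication contributes \<open>h\<close>; the
    common factor \<open>h\<close> cancels.\<close>
  have "smult a2 (co (T xv) 1 0) = smult a1 (co (T xv) 1 0)"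
    using arg_cong[OF X, of "\<lambda>D. co D 1 0"]
    by (simp add: co_sc co_opH_mult co_mult_opH[OF ran] iter_linear)
  then have x: "co (T xv) 1 0 = 0" by (rule smult_eq_smult_imp_0) (use neq in auto)
  have "smult 1 (co (T yv) 1 0) = smult (a1 * a2) (co (T yv) 1 0)"
    using arg_cong[OF Y, of "\<lambda>D. co D 1 0"]
    by (simp add: co_sc co_opH_mult co_mult_opH[OF ran] iter_linear)
  then have y: "co (T yv) 1 0 = 0" by (rule smult_eq_smult_imp_0) (use neq in auto)
  have h: "co (T hv) 1 0 = 0"
    by (simp add: H co_sc co_opH delta_def)
  \<comment> \<open>By the Leibniz rule no image has a linear \<open>x\<close>-term at
    \<open>h = 0\<close>, yet \<open>u2\<close> is mapped to \<open>x\<close>.\<close>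
  have "poly (co (T u) 1 0) 0 = 0" for u
  proof (induction u rule: freealg_induct)
    case (mult u v)
    then show ?case
      by (simp only: alg_homD[OF hom] poly_co_derivation[OF fix2 ran ran] mult_zero_left mult_zero_right add_0)
  qed (simp_all add: alg_homD[OF hom] x[unfolded One_nat_def] y[unfolded One_nat_def]
      h[unfolded One_nat_def] co_osc delta_def)
  from this[of u2] show False by (simp add: u2 co_opX delta_def)
qed

lemma alg_iso_refl: "alg_iso f f"
  by (rule alg_iso_conj[of 1 f f 0]) simp_all

lemma alg_iso_linear_shift:
  assumes "a \<noteq> 1" shows "alg_iso [:b, a:] [:b', a:]"
proof -
  \<comment> \<open>Conjugation by the translation \<open>h + d\<close> adds
    \<open>(1 - a) d\<close> to the constant term.\<close>
  define d where "d = (b' - b) / (1 - a)"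
  have "d * (1 - a) = b' - b" using assms by (simp add: d_def)
  then have "b' = b - a * d + d" by (simp add: algebra_simps)
  then show ?thesis
    by (intro alg_iso_conj[of 1 _ _ d]) (simp_all add: pcompose_pCons)
qed

lemma alg_iso_inverse_slope:
  assumes "a \<noteq> 0" "a \<noteq> 1" shows "alg_iso [:b, inverse a:] [:b', a:]"
proof -
  have "alg_iso [:b, inverse a:] [:0, inverse a:]"
    by (rule alg_iso_linear_shift) (use assms in \<open>simp add: inverse_eq_1_iff\<close>)
  moreover have "alg_iso [:0, inverse a:] [:0, a:]"
    by (rule alg_iso_inverse) (use assms in \<open>simp_all add: pcompose_pCons\<close>)
  moreover have "alg_iso [:0, a:] [:b', a:]" by (rule alg_iso_linear_shift[OF assms(2)])
  ultimately show ?thesis by (blast intro: alg_iso_trans)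
qed

lemma alg_iso_degree_1:
  assumes iso: "alg_iso [:b1, a1:] [:b2, a2:]" and a: "a1 \<noteq> 0" "a2 \<noteq> 0"
  shows "(a1 = 1 \<and> a2 = 1 \<and> (b1 = 0 \<longleftrightarrow> b2 = 0)) \<or> (a1 \<noteq> 1 \<and> (a1 = a2 \<or> a1 = inverse a2))"
proof -
  have slope: "a = 1" if "alg_iso [:b', 1:] [:b, a:]" for a b b'
  proof (rule ccontr)
    assume "a \<noteq> 1"
    \<comment> \<open>A slope other than 1 has a fixed point, which excludes a nonzero translation;
      the zero translation is excluded by \<open>alg_iso_identity\<close>.\<close>
    then have "poly [:b, a:] (b / (1 - a)) = b / (1 - a)" by (simp add: field_simps)
    then have "b' = 0" using not_alg_iso_translation[OF that] by blast
    then show False using alg_iso_identity[of "[:b, a:]"] that \<open>a \<noteq> 1\<close> by simp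
  qed
  have "a1 = a2 \<or> a1 * a2 = 1" if "a1 \<noteq> 1" "a2 \<noteq> 1"
  proof -
    have "alg_iso [:0, a1:] [:0, a2:]"
      using alg_iso_trans[OF alg_iso_trans[OF alg_iso_linear_shift[OF that(1)] iso] alg_iso_linear_shift[OF that(2)]] .
    then show ?thesis using alg_iso_linear a that by blast
  qed
  moreover have "b1 = 0 \<longleftrightarrow> b2 = 0" if "a1 = 1" "a2 = 1"
    using alg_iso_identity[of "[:b2, a2:]"] alg_iso_identity[of "[:b1, a1:]"] iso alg_iso_sym[OF iso] that
    by auto
  moreover have "a1 = inverse a2" if "a1 * a2 = 1"
    using that by (metis inverse_unique mult.commute)
  ultimately show ?thesis
    using slope[of b1 b2 a2] slope[of b2 b1 a1] iso alg_iso_sym[OF iso] by blast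
qed

theorem theorem5:
  fixes f1 f2 :: "complex poly"
  shows "alg_iso f1 f2 \<longleftrightarrow>
    ((degree f1 = 0 \<and> degree f2 = 0)
     \<or> (f1 = [:0, 1:] \<and> f2 = [:0, 1:])
     \<or> (\<exists>c1 c2. c1 \<noteq> 0 \<and> c2 \<noteq> 0 \<and> f1 = [:c1, 1:] \<and> f2 = [:c2, 1:])
     \<or> (\<exists>a1 a2 b1 b2. f1 = [:b1, a1:] \<and> f2 = [:b2, a2:] \<and>
          (a1 = a2 \<or> (a2 \<noteq> 0 \<and> a1 = inverse a2)) \<and> a1 \<noteq> 1)
     \<or> (degree f1 \<ge> 2 \<and> (\<exists>a c. a \<noteq> 0 \<and>
          f2 = smult a (pcompose f1 [:- c / a, 1 / a:]) + [:c:])))"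
    (is "_ \<longleftrightarrow> ?R")
proof
  assume iso: "alg_iso f1 f2"
  note sym = alg_iso_sym[OF iso]
  consider "degree f1 = 0" | "degree f1 = 1" | "degree f1 \<ge> 2" by linarith
  then show ?R
  proof cases
    case 1
    then show ?thesis using alg_iso_degree_0[OF sym] by simp
  next
    case 2
    have "degree f2 \<noteq> 0" using alg_iso_degree_0[OF iso] 2 by fastforce
    moreover have "\<not> degree f2 \<ge> 2" using alg_iso_degree_ge_2[OF sym] 2 by auto
    ultimately have "degree f2 = 1" by linarith
    then obtain b2 a2 where f2: "f2 = [:b2, a2:]" "a2 \<noteq> 0" by (metis degree1_coeffs)
    obtain b1 a1 where f1: "f1 = [:b1, a1:]" "a1 \<noteq> 0" using 2 by (metis degree1_coeffs)
    show ?thesis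
      using alg_iso_degree_1[OF iso[unfolded f1(1) f2(1)] f1(2) f2(2)] f1 f2 by auto
  next
    case 3
    have "degree f2 \<ge> 1" using alg_iso_degree_0[OF iso] 3 by force
    then show ?thesis using alg_iso_imp_conj[OF iso 3] 3 by metis
  qed
next
  assume ?R
  then show "alg_iso f1 f2"
  proof (elim disjE exE conjE)
    assume "degree f1 = 0" "degree f2 = 0"
    then obtain c1 c2 where "f1 = [:c1:]" "f2 = [:c2:]" by (metis degree_eq_zeroE)
    then show ?thesis by (intro alg_iso_conj[of 1 _ _ "c2 - c1"]) simp_all
  next
    assume "f1 = [:0, 1:]" "f2 = [:0, 1:]"
    then show ?thesis by (simp add: alg_iso_refl)
  next
    fix c1 c2 assume "c1 \<noteq> 0" "c2 \<noteq> 0" "f1 = [:c1, 1:]" "f2 = [:c2, 1:]"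
    \<comment> \<open>Scaling by \<open>a\<close> turns the translation by \<open>c1\<close> into
      the translation by \<open>a c1\<close>.\<close>
    then show ?thesis by (intro alg_iso_conj[of "c2 / c1" _ _ 0]) (simp_all add: pcompose_pCons)
  next
    fix a1 a2 b1 b2 assume "f1 = [:b1, a1:]" "f2 = [:b2, a2:]" "a1 \<noteq> 1" "a1 = a2"
    then show ?thesis by (simp add: alg_iso_linear_shift)
  next
    fix a1 a2 b1 b2
    assume "f1 = [:b1, a1:]" "f2 = [:b2, a2:]" "a1 \<noteq> 1" "a2 \<noteq> 0" "a1 = inverse a2"
    then show ?thesis by (auto intro: alg_iso_inverse_slope)
  next
    fix a c assume "a \<noteq> 0" "f2 = smult a (pcompose f1 [:- c / a, 1 / a:]) + [:c:]"
    then show ?thesis by (rule alg_iso_conj)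
  qed
qed

end
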